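(* Assume that there exists $\kappa>0$ such that for each $M$ large enough, the following condition holds: $$|\lambda_{k,N}-\lambda_{l,N}|\le\kappa\left(\frac{|k-l|}{M}\right)^{1/2}$$ for each pair $(k,l)$, $1\le k\le l\le M$. Then, for each $M$ large enough, $\mathcal{S}_N=[0,x_{+,N}]$ if $c_N\le1$ and $\mathcal{S}_N=\{0\}\cup[x_{-,N},x_{+,N}]$ if $c_N>1$.
   Context: $L\ge 1$ is a fixed integer, $M=M(N)$ are integers such that $c_N=ML/N\to c_*>0$ as $N\to\infty$. $(R_N)_{N\ge1}$ are $M\times M$ Hermitian positive definite matrices with $aI_M\le R_N<bI_M$ for all $N$, where $a,b>0$ do not depend on $N$; $\lambda_{1,N}\ge\dots\ge\lambda_{M,N}$ are the eigenvalues of $R_N$. For $z\in\mathbb{C}^+$ (open upper half plane), $t_N(z)$ is the unique solution with $t_N(z)\in\mathbb{C}^+$, $zt_N(z)\in\mathbb{C}^+$ of $t_N(z)=\frac1M\mathrm{Tr}\,R_N\left(-zI_M-\frac{zc_Nt_N(z)}{1-zc_N^2t_N(z)^2}R_N\right)^{-1}$. $t_N$ is the Stieltjes transform $\int\frac{d\mu_N(\lambda)}{\lambda-z}$ of a positive finite measure $\mu_N$ carried by $[0,\infty)$, with support $\mathcal{S}_N$. Define $\phi_N(w)=c_Nw^2\,\frac1M\mathrm{Tr}R_N(R_N-wI)^{-1}\left(c_N\frac1M\mathrm{Tr}R_N(R_N-wI)^{-1}-1\right)$. $w_{+,N}$ is the unique point of $]\lambda_{1,N},+\infty[$ at which $\phi_N'$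 vanishes, and $x_{+,N}=\phi_N(w_{+,N})$. If $c_N>1$, the smallest root $\omega_{1,N}$ of $\frac1M\mathrm{Tr}R_N(R_N-wI)^{-1}=\frac1{c_N}$ is strictly negative, $w_{-,N}$ is the unique point of $]\omega_{1,N},0[$ at which $\phi_N'$ vanishes, and $x_{-,N}=\phi_N(w_{-,N})$. *)

theory Defs
  imports
    "HOL-Analysis.Analysis"
    "HOL-Computational_Algebra.Computational_Algebra"
    "Jordan_Normal_Form.Char_Poly"
    "Jordan_Normal_Form.Gauss_Jordan_Elimination"
    "Jordan_Normal_Form.Schur_Decomposition"
begin

definition hermitian_mat :: "complex mat \<Rightarrow> bool" where
  "hermitian_mat A \<longleftrightarrow> square_mat A \<and> mat_adjoint A = A"

text \<open>For Hermitian \<open>A\<close> the form \<open>\<langle>A v, v\<rangle>\<close> is real, so taking \<open>Re\<close> loses nothing.\<close>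

definition pos_semidef_mat :: "complex mat \<Rightarrow> bool" where
  "pos_semidef_mat A \<longleftrightarrow> hermitian_mat A \<and>
     (\<forall>v \<in> carrier_vec (dim_row A). 0 \<le> Re ((A *\<^sub>v v) \<bullet>c v))"

definition pos_def_mat :: "complex mat \<Rightarrow> bool" where
  "pos_def_mat A \<longleftrightarrow> hermitian_mat A \<and>
     (\<forall>v \<in> carrier_vec (dim_row A). v \<noteq> 0\<^sub>v (dim_row A) \<longrightarrow> 0 < Re ((A *\<^sub>v v) \<bullet>c v))"

definition mat_trace :: "complex mat \<Rightarrow> complex" where
  "mat_trace A = (\<Sum>i<dim_row A. A $$ (i, i))"

text \<open>Meaningful only for invertible \<open>A\<close>; otherwise \<open>mat_inverse A\<close> is \<open>None\<close> and the value is
  unspecified.\<close>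

definition minv :: "complex mat \<Rightarrow> complex mat" where
  "minv A = the (mat_inverse A)"

text \<open>The \<open>k\<close>-th largest eigenvalue, \<open>1 \<le> k \<le> dim_row A\<close>, counted with multiplicity.  It is used
  for Hermitian matrices only, whose eigenvalues are real.\<close>

definition eigval :: "complex mat \<Rightarrow> nat \<Rightarrow> real" where
  "eigval A k =
     rev (sorted_list_of_multiset (image_mset Re (proots (char_poly A)))) ! (k - 1)"

definition canonical_eq :: "real \<Rightarrow> complex mat \<Rightarrow> complex \<Rightarrow> complex \<Rightarrow> bool" where
  "canonical_eq c R z t \<longleftrightarrow>
     t = 1 / of_nat (dim_row R) *
       mat_trace (R * minv ((- z) \<cdot>\<^sub>m 1\<^sub>m (dim_row R)
         - (z * of_real c * t / (1 - z * (of_real c)\<^sup>2 * t\<^sup>2)) \<cdot>\<^sub>m R))"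

text \<open>In the upper half plane, \<open>t\<close> and \<open>z * t\<close> both having positive imaginary part guarantees that
  the denominator and the inverted matrix of the equation are nonsingular.\<close>

definition canonical_solution :: "real \<Rightarrow> complex mat \<Rightarrow> complex \<Rightarrow> complex \<Rightarrow> bool" where
  "canonical_solution c R z t \<longleftrightarrow> Im t > 0 \<and> Im (z * t) > 0 \<and> canonical_eq c R z t"

text \<open>\<open>(1/M) Tr R (R - w I)\<^sup>-\<^sup>1\<close> for real \<open>w\<close> outside the spectrum of the Hermitian matrix \<open>R\<close>,
  where it is a real number.\<close>

definition res_trace :: "complex mat \<Rightarrow> real \<Rightarrow> real" where
  "res_trace R w = Re (1 / of_nat (dim_row R) *
     mat_trace (R * minv (R - of_real w \<cdot>\<^sub>m 1\<^sub>m (dim_row R))))"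

definition phi :: "real \<Rightarrow> complex mat \<Rightarrow> real \<Rightarrow> real" where
  "phi c R w = c * w\<^sup>2 * res_trace R w * (c * res_trace R w - 1)"

definition unique_critical_point :: "(real \<Rightarrow> real) \<Rightarrow> real set \<Rightarrow> real \<Rightarrow> bool" where
  "unique_critical_point f S w \<longleftrightarrow>
     (\<forall>v. v \<in> S \<and> (f has_real_derivative 0) (at v) \<longleftrightarrow> v = w)"

definition smallest_root :: "real \<Rightarrow> complex mat \<Rightarrow> real \<Rightarrow> bool" where
  "smallest_root c R w \<longleftrightarrow>
     (let roots = {v. \<not> eigenvalue R (of_real v) \<and> res_trace R v = 1 / c}
      in w \<in> roots \<and> (\<forall>v \<in> roots. w \<le> v))"

definition measure_support :: "real measure \<Rightarrow> real set" where
  "measure_support \<mu> = {x. \<forall>U. open U \<and> x \<in> U \<longrightarrow> emeasure \<mu> U > 0}"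

definition stieltjes :: "real measure \<Rightarrow> complex \<Rightarrow> complex" where
  "stieltjes \<mu> z = (LINT x|\<mu>. 1 / (of_real x - z))"

end

theory Submission
  imports Defs "HOL-Complex_Analysis.Conformal_Mappings" "HOL-Real_Asymp.Real_Asymp"
begin

text \<open>
  Why the theorem holds. Let \<open>\<lambda>\<^sub>1 \<ge> \<dots> \<ge> \<lambda>\<^sub>M\<close> be the eigenvalues of \<open>R\<close> and put
  \<open>q(w) = (c/M) \<Sum> \<lambda>\<^sub>k w / (\<lambda>\<^sub>k - w)\<close>. In the companion variable
  \<open>w = c z t(z) - 1 / (c t(z))\<close> the canonical equation is the identity \<open>q(w) = c z t(z)\<close>, and then
  \<open>z = q(w) (q(w) - w)\<close>, which is the function \<open>\<phi>(w)\<close> of the statement. So \<open>w(z)\<close> inverts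
  \<open>\<phi>\<close>, and the support of \<open>\<mu>\<close> has to be read off the real branches of \<open>\<phi>\<close>.

  Two identities replace the analytic continuation of \<open>t\<close> to the real line:
  \<open>Im q(w) = Im w \<cdot> q_slope w\<close> with \<open>q_slope w = (c/M) \<Sum> \<lambda>\<^sub>k\<^sup>2 / \<bar>\<lambda>\<^sub>k - w\<bar>\<^sup>2\<close>, and
  \<open>Im \<phi>(w) = Im w \<cdot> Phi_slope w\<close>. On the real axis the two factors are the derivatives of \<open>q\<close>
  and \<open>\<phi>\<close>. Since \<open>Im t > 0\<close>, the first one gives \<open>q_slope w < 1\<close> at every companion point.

  If \<open>w\<close> is real with \<open>\<phi>'(w) > 0\<close>, \<open>q(w) < 0\<close> and \<open>q(w) < w\<close>, the open mapping theorem
  covers a neighbourhood of \<open>\<phi>(w)\<close> by companion points and gives \<open>Im t(x + iy) = O(y)\<close> there, which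
  leaves no room for mass (\<open>increasing_branch_outside_support\<close>). Conversely, at a real point \<open>x\<close>
  outside the support the companion variable converges to a real \<open>w\<close>. As long as this limit avoids
  \<open>[\<lambda>\<^sub>M, \<lambda>\<^sub>1]\<close>, it satisfies \<open>\<phi>(w) = x\<close>, \<open>\<phi>'(w) > 0\<close> and \<open>q_slope w \<le> 1\<close>
  (\<open>companion_real_point\<close>).

  The spacing condition is what keeps the limit out of \<open>[\<lambda>\<^sub>M, \<lambda>\<^sub>1]\<close>: for a point of that interval
  the \<open>j\<close>-th nearest eigenvalue on either side is at distance at most of order \<open>(j/M)\<^sup>1\<^sup>/\<^sup>2\<close>, so
  \<open>q_slope\<close> is at least a constant times the harmonic number of \<open>M\<close>. For large \<open>M\<close> this
  exceeds 1 (\<open>q_slope_ge_1_near_spectrum\<close>), and no gap can open inside the bulk.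

  What remains are the two outer branches. To the right of \<open>\<lambda>\<^sub>1\<close> the function \<open>\<phi>\<close> falls from infinity to its
  minimum \<open>x\<^sub>+\<close> and rises again; on \<open>]\<omega>\<^sub>1, 0[\<close>, when \<open>c > 1\<close>, it rises from 0 to its maximum
  \<open>x\<^sub>-\<close> and falls back. The increasing parts take exactly the values above \<open>x\<^sub>+\<close> and between 0 and
  \<open>x\<^sub>-\<close> (\<open>upper_edge\<close>, \<open>lower_edge\<close>), and \<open>x\<^sub>- < x\<^sub>+\<close> because the value \<open>(c Tr R / M)\<^sup>2\<close>
  separates the two branches. Finally 0 is always in the support: otherwise the limit \<open>w\<close> at
  \<open>x = 0\<close> would be negative with \<open>q(w) = 0\<close>, although \<open>q < 0\<close> on the negative axis.
\<close>

section \<open>Traces of resolvents of Hermitian matrices\<close>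

lemma mat_trace_mult:
  assumes "A \<in> carrier_mat n m" "B \<in> carrier_mat m n"
  shows "mat_trace (A * B) = (\<Sum>i<n. \<Sum>k<m. A $$ (i,k) * B $$ (k,i))"
  using assms by (auto simp: mat_trace_def scalar_prod_def lessThan_atLeast0 intro!: sum.cong)

lemma mat_trace_mult_commute:
  assumes "A \<in> carrier_mat n m" "B \<in> carrier_mat m n"
  shows "mat_trace (A * B) = mat_trace (B * A)"
  unfolding mat_trace_mult[OF assms] mat_trace_mult[OF assms(2,1)]
  by (subst sum.swap) (simp add: mult.commute)

text \<open>
  Column by column: below the diagonal, all terms of the entry \<open>(i,j)\<close> of \<open>Y * X\<close> other than
  \<open>Y\<^sub>i\<^sub>j X\<^sub>j\<^sub>j\<close> vanish, by the triangularity of \<open>X\<close> or by the columns of \<open>Y\<close> treated before.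
\<close>

lemma upper_triangular_left_inverse:
  fixes X Y :: "'a :: field mat"
  assumes X: "X \<in> carrier_mat n n" and Y: "Y \<in> carrier_mat n n"
    and ut: "upper_triangular X" and YX: "Y * X = 1\<^sub>m n"
  shows "j < n \<Longrightarrow> Y $$ (j,j) * X $$ (j,j) = 1"
    and "j < i \<Longrightarrow> i < n \<Longrightarrow> Y $$ (i,j) = 0"
proof -
  have entry: "(\<Sum>k<n. Y $$ (i,k) * X $$ (k,j)) = (if i = j then 1 else 0)"
    if "i < n" "j < n" for i j
  proof -
    have "(Y * X) $$ (i,j) = (\<Sum>k<n. Y $$ (i,k) * X $$ (k,j))"
      using X Y that by (auto simp: scalar_prod_def lessThan_atLeast0 intro!: sum.cong)
    then show ?thesis using YX that by simp
  qed
  have "Y $$ (j,j) * X $$ (j,j) = 1 \<and> (\<forall>i. j < i \<longrightarrow> i < n \<longrightarrow> Y $$ (i,j) = 0)" if "j < n" for j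
    using that
  proof (induction j rule: less_induct)
    case (less j)
    have col: "(\<Sum>k<n. Y $$ (i,k) * X $$ (k,j)) = Y $$ (i,j) * X $$ (j,j)"
      if "j \<le> i" "i < n" for i
    proof -
      have "Y $$ (i,k) * X $$ (k,j) = (if k = j then Y $$ (i,j) * X $$ (j,j) else 0)"
        if "k < n" for k
      proof (cases k j rule: linorder_cases)
        case less': less
        then show ?thesis using less.IH[of k] \<open>j \<le> i\<close> \<open>i < n\<close> that by auto
      next
        case greater
        then show ?thesis using ut X that by (auto simp: upper_triangular_def)
      qed auto
      then have "(\<Sum>k<n. Y $$ (i,k) * X $$ (k,j)) =
          (\<Sum>k<n. if k = j then Y $$ (i,j) * X $$ (j,j) else 0)"
        by (intro sum.cong) simp_all
      then show ?thesis using less.prems by simp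
    qed
    have one: "Y $$ (j,j) * X $$ (j,j) = 1"
      using col[of j] entry[of j j] less.prems by simp
    have "Y $$ (i,j) = 0" if "j < i" "i < n" for i
      using col[of i] entry[of i j] that one by auto
    then show ?case using one by blast
  qed
  then show "j < n \<Longrightarrow> Y $$ (j,j) * X $$ (j,j) = 1"
    and "j < i \<Longrightarrow> i < n \<Longrightarrow> Y $$ (i,j) = 0" by auto
qed

lemma minv_inverse:
  assumes "X \<in> carrier_mat n n" "det X \<noteq> 0"
  shows "minv X \<in> carrier_mat n n" "minv X * X = 1\<^sub>m n"
proof -
  obtain Y where "mat_inverse X = Some Y"
    using mat_inverse(1)[OF assms(1)] det_non_zero_imp_unit[OF assms] by (metis option.exhaust)
  with mat_inverse(2)[OF assms(1) this] show "minv X \<in> carrier_mat n n" "minv X * X = 1\<^sub>m n"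
    by (auto simp: minv_def)
qed

text \<open>
  The trace is invariant under the Schur triangularization of \<open>R\<close>, which makes \<open>R\<close> and the inverse
  upper triangular at once; only their diagonals contribute to the trace of the
  product.
\<close>

lemma mat_trace_mult_minv:
  fixes R :: "complex mat"
  assumes R: "R \<in> carrier_mat n n" and cp: "char_poly R = (\<Prod>e\<leftarrow>es. [:- e, 1:])"
    and nz: "\<And>e. e \<in> set es \<Longrightarrow> \<beta> + \<gamma> * e \<noteq> 0"
  shows "mat_trace (R * minv (\<beta> \<cdot>\<^sub>m 1\<^sub>m n + \<gamma> \<cdot>\<^sub>m R)) = (\<Sum>e\<leftarrow>es. e / (\<beta> + \<gamma> * e))"
proof -
  obtain B P Q where "schur_decomposition R es = (B, P, Q)" by (metis prod_cases3)
  from schur_decomposition[OF R cp this]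
  have sim: "similar_mat_wit R B P Q" and ut: "upper_triangular B" and diag: "diag_mat B = es" by auto
  from similar_mat_witD2[OF R sim]
  have PQ: "P * Q = 1\<^sub>m n" and QP: "Q * P = 1\<^sub>m n" and RPBQ: "R = P * B * Q"
    and B: "B \<in> carrier_mat n n" and P: "P \<in> carrier_mat n n" and Q: "Q \<in> carrier_mat n n" by auto
  have len: "length es = n" and es: "\<And>i. i < n \<Longrightarrow> es ! i = B $$ (i,i)"
    using diag B by (auto simp: diag_mat_def)
  define X where "X = \<beta> \<cdot>\<^sub>m 1\<^sub>m n + \<gamma> \<cdot>\<^sub>m R"
  define X' where "X' = \<beta> \<cdot>\<^sub>m 1\<^sub>m n + \<gamma> \<cdot>\<^sub>m B"
  have X: "X \<in> carrier_mat n n" and X': "X' \<in> carrier_mat n n" using R B by (auto simp: X_def X'_def)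
  have QRP: "Q * R * P = B"
  proof -
    have "Q * R * P = (Q * P) * B * (Q * P)" using P Q B unfolding RPBQ by (simp add: assoc_mult_mat[of _ n n _ n _ n])
    then show ?thesis using B QP by simp
  qed
  have X'_eq: "X' = Q * X * P"
  proof -
    have "Q * X = \<beta> \<cdot>\<^sub>m Q + \<gamma> \<cdot>\<^sub>m (Q * R)"
      using Q R unfolding X_def
      by (simp add: mult_add_distrib_mat[of _ n n _ n] mult_smult_distrib[of _ n n _ n])
    then have "Q * X * P = \<beta> \<cdot>\<^sub>m (Q * P) + \<gamma> \<cdot>\<^sub>m (Q * R * P)"
      using P Q R
      by (simp add: add_mult_distrib_mat[of _ n n _ _ n] mult_smult_assoc_mat[of _ n n _ n])
    then show ?thesis by (simp add: QP QRP X'_def)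
  qed
  have ut': "upper_triangular X'" using ut B by (auto simp: X'_def upper_triangular_def)
  have diag': "X' $$ (i,i) = \<beta> + \<gamma> * es ! i" if "i < n" for i
    using that B es by (simp add: X'_def)
  have "det X' = prod_list (diag_mat X')" using det_upper_triangular[OF ut' X'] .
  also have "\<dots> \<noteq> 0"
  proof -
    have "X' $$ (i,i) \<noteq> 0" if "i < n" for i
      using nz[of "es ! i"] diag'[OF that] len that by simp
    then show ?thesis using X' by (auto simp: prod_list_zero_iff diag_mat_def)
  qed
  finally have "det X' \<noteq> 0" .
  then have "det X \<noteq> 0" unfolding X'_eq using X P Q by (auto simp: det_mult[of _ n])
  define Y where "Y = minv X"
  define Y' where "Y' = Q * Y * P"
  have Y: "Y \<in> carrier_mat n n" and YX: "Y * X = 1\<^sub>m n"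
    using minv_inverse[OF X \<open>det X \<noteq> 0\<close>] by (auto simp: Y_def)
  have Y': "Y' \<in> carrier_mat n n" using Y P Q by (simp add: Y'_def)
  have "Y' * X' = Q * Y * (P * Q) * X * P"
    using X Y P Q unfolding X'_eq Y'_def by (simp add: assoc_mult_mat[of _ n n _ n _ n])
  also have "\<dots> = Q * (Y * X) * P"
    unfolding PQ using X Y P Q by (simp add: assoc_mult_mat[of _ n n _ n _ n])
  also have "\<dots> = 1\<^sub>m n" using P Q QP YX by simp
  finally have YX': "Y' * X' = 1\<^sub>m n" .
  note tri = upper_triangular_left_inverse[OF X' Y' ut' YX']
  have "mat_trace (R * Y) = mat_trace (P * (B * Q * Y))"
    unfolding RPBQ using P Q B Y by (simp add: assoc_mult_mat[of _ n n _ n _ n])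
  also have "\<dots> = mat_trace (B * Q * Y * P)"
    by (rule mat_trace_mult_commute[of _ n n]) (use P Q B Y in auto)
  also have "B * Q * Y * P = B * Y'"
    unfolding Y'_def using P Q B Y by (simp add: assoc_mult_mat[of _ n n _ n _ n])
  also have "mat_trace (B * Y') = (\<Sum>i<n. \<Sum>k<n. B $$ (i,k) * Y' $$ (k,i))"
    by (rule mat_trace_mult[OF B Y'])
  also have "\<dots> = (\<Sum>i<n. es ! i / (\<beta> + \<gamma> * es ! i))"
  proof (rule sum.cong[OF refl])
    fix i assume "i \<in> {..<n}"
    then have i: "i < n" by simp
    have "B $$ (i,k) * Y' $$ (k,i) = (if k = i then B $$ (i,i) * Y' $$ (i,i) else 0)" if "k < n" for k
      using ut B tri(2)[of i k] that i by (cases k i rule: linorder_cases) (auto simp: upper_triangular_def)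
    then have "(\<Sum>k<n. B $$ (i,k) * Y' $$ (k,i)) =
        (\<Sum>k<n. if k = i then B $$ (i,i) * Y' $$ (i,i) else 0)"
      by (intro sum.cong) simp_all
    also have "\<dots> = B $$ (i,i) * Y' $$ (i,i)" using i by simp
    also have "\<dots> = es ! i / (\<beta> + \<gamma> * es ! i)"
    proof -
      have "X' $$ (i,i) \<noteq> 0" using tri(1)[OF i] by auto
      then have "Y' $$ (i,i) = 1 / X' $$ (i,i)" using tri(1)[OF i] by (simp add: field_simps)
      then show ?thesis using diag'[OF i] es[OF i] by simp
    qed
    finally show "(\<Sum>k<n. B $$ (i,k) * Y' $$ (k,i)) = es ! i / (\<beta> + \<gamma> * es ! i)" .
  qed
  also have "\<dots> = (\<Sum>e\<leftarrow>es. e / (\<beta> + \<gamma> * e))"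
    using len by (simp add: sum_list_sum_nth lessThan_atLeast0)
  finally show ?thesis by (simp add: Y_def X_def)
qed

lemma hermitian_mat_entry:
  assumes "hermitian_mat A" "A \<in> carrier_mat n n" "i < n" "j < n"
  shows "A $$ (i,j) = cnj (A $$ (j,i))"
proof -
  have "A $$ (i,j) = mat_adjoint A $$ (i,j)" using assms by (simp add: hermitian_mat_def)
  also have "\<dots> = cnj (A $$ (j,i))"
    using assms(2-) by (simp add: mat_adjoint_def mat_of_rows_def cols_def vec_eq_iff conjugate_complex_def)
  finally show ?thesis .
qed

lemma quadratic_form_sum:
  assumes "A \<in> carrier_mat n n" "v \<in> carrier_vec n"
  shows "(A *\<^sub>v v) \<bullet>c v = (\<Sum>i<n. \<Sum>j<n. A $$ (i,j) * v $ j * cnj (v $ i))"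
  using assms
  by (auto simp: scalar_prod_def lessThan_atLeast0 sum_distrib_right conjugate_complex_def intro!: sum.cong)

text \<open>
  Conjugation only exchanges the two summation indices of the Hermitian form.
\<close>

lemma hermitian_eigenvalue_real:
  assumes H: "hermitian_mat A" and A: "A \<in> carrier_mat n n" and e: "eigenvalue A e"
  shows "e \<in> \<real>"
proof -
  obtain v where v: "v \<in> carrier_vec n" "v \<noteq> 0\<^sub>v n" "A *\<^sub>v v = e \<cdot>\<^sub>v v"
    using e A by (auto simp: eigenvalue_def eigenvector_def)
  define s where "s = v \<bullet>c v"
  have "s > 0" using v by (simp add: s_def)
  then have s: "s \<noteq> 0" "cnj s = s" by (auto simp: less_complex_def complex_eq_iff)
  have form: "(A *\<^sub>v v) \<bullet>c v = e * s" using v by (simp add: s_def)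
  have "cnj (\<Sum>i<n. \<Sum>j<n. A $$ (i,j) * v $ j * cnj (v $ i)) =
      (\<Sum>i<n. \<Sum>j<n. A $$ (j,i) * v $ i * cnj (v $ j))"
    unfolding cnj_sum
  proof (intro sum.cong refl)
    fix i j assume "i \<in> {..<n}" "j \<in> {..<n}"
    then show "cnj (A $$ (i,j) * v $ j * cnj (v $ i)) = A $$ (j,i) * v $ i * cnj (v $ j)"
      using hermitian_mat_entry[OF H A, of j i] by simp
  qed
  also have "\<dots> = (\<Sum>i<n. \<Sum>j<n. A $$ (i,j) * v $ j * cnj (v $ i))" by (rule sum.swap)
  finally have "cnj (e * s) = e * s" unfolding form[symmetric] quadratic_form_sum[OF A v(1)] .
  then have "cnj e = e" using s by simp
  then show ?thesis by (simp add: Reals_cnj_iff)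
qed

lemma eigenvalue_ge_if_pos_semidef:
  assumes A: "A \<in> carrier_mat n n" and pos: "pos_semidef_mat (A - of_real a \<cdot>\<^sub>m 1\<^sub>m n)"
    and e: "eigenvalue A e"
  shows "a \<le> Re e"
proof -
  obtain v where v: "v \<in> carrier_vec n" "v \<noteq> 0\<^sub>v n" "A *\<^sub>v v = e \<cdot>\<^sub>v v"
    using e A by (auto simp: eigenvalue_def eigenvector_def)
  define s where "s = v \<bullet>c v"
  have "s > 0" using v by (simp add: s_def)
  then have s: "Re s > 0" "Im s = 0" by (auto simp: less_complex_def)
  have "(complex_of_real a \<cdot>\<^sub>m 1\<^sub>m n) *\<^sub>v v = of_real a \<cdot>\<^sub>v v"
    using v(1) by (intro eq_vecI) (auto simp: scalar_prod_def if_distrib[of "\<lambda>x. _ * x * _"] if_distrib[of "\<lambda>x. x * _"] cong: if_cong)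
  then have "(A - of_real a \<cdot>\<^sub>m 1\<^sub>m n) *\<^sub>v v = e \<cdot>\<^sub>v v - of_real a \<cdot>\<^sub>v v"
    using A v by (simp add: minus_mult_distrib_mat_vec[of _ n n])
  also have "\<dots> = (e - of_real a) \<cdot>\<^sub>v v"
    using v(1) by (intro eq_vecI) (auto simp: algebra_simps)
  finally have "(A - of_real a \<cdot>\<^sub>m 1\<^sub>m n) *\<^sub>v v = (e - of_real a) \<cdot>\<^sub>v v" .
  then have "((A - of_real a \<cdot>\<^sub>m 1\<^sub>m n) *\<^sub>v v) \<bullet>c v = (e - of_real a) * s"
    using v by (simp add: s_def)
  moreover have "0 \<le> Re (((A - of_real a \<cdot>\<^sub>m 1\<^sub>m n) *\<^sub>v v) \<bullet>c v)"
    using pos v(1) A by (auto simp: pos_semidef_mat_def)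
  ultimately have "0 \<le> (Re e - a) * Re s" using s by simp
  then show ?thesis using s by (simp add: zero_le_mult_iff)
qed

text \<open>
  This replaces the selection and sorting in \<open>eigval\<close> by a list that factors the characteristic
  polynomial, to which the Schur triangularization applies directly.
\<close>

lemma ex_real_spectrum_list:
  assumes H: "hermitian_mat R" and R: "R \<in> carrier_mat n n"
  obtains ls where "length ls = n" "sorted_wrt (\<ge>) ls"
    "char_poly R = (\<Prod>e\<leftarrow>map complex_of_real ls. [:- e, 1:])"
    "\<And>k. eigval R k = ls ! (k - 1)"
proof -
  obtain es where cp: "char_poly R = (\<Prod>e\<leftarrow>es. [:- e, 1:])" and len: "length es = n"
    using char_poly_factorized[OF R] by auto
  have real: "complex_of_real (Re e) = e" if "e \<in> set es" for e
  proof -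
    have "poly (char_poly R) e = 0" using that by (auto simp: cp poly_prod_list prod_list_zero_iff)
    then have "eigenvalue R e" using eigenvalue_root_char_poly[OF R] by simp
    then show ?thesis using hermitian_eigenvalue_real[OF H R] of_real_Re by blast
  qed
  define ls where "ls = rev (sort (map Re es))"
  have ms: "mset (map complex_of_real ls) = mset es"
  proof -
    have "mset (map complex_of_real ls) = image_mset (\<lambda>e. complex_of_real (Re e)) (mset es)"
      by (simp add: ls_def image_mset.compositionality o_def)
    also have "\<dots> = image_mset (\<lambda>e. e) (mset es)" by (rule image_mset_cong) (use real in auto)
    finally show ?thesis by simp
  qed
  have "mset (map (\<lambda>e. [:- e, 1:]) es) = mset (map (\<lambda>e. [:- e, 1:]) (map complex_of_real ls))"
    using ms by (metis mset_map)
  then have cp': "char_poly R = (\<Prod>e\<leftarrow>map complex_of_real ls. [:- e, 1:])"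
    unfolding cp by (metis prod_mset_prod_list)
  have "proots (char_poly R) = mset es"
  proof -
    have "proots (\<Prod>e\<leftarrow>es. [:- e, 1:]) = mset es"
    proof (induction es)
      case (Cons e es)
      have "(\<Prod>e\<leftarrow>es. [:- e, 1:]) \<noteq> 0" by (auto simp: prod_list_zero_iff)
      then have "proots ([:- e, 1:] * (\<Prod>e\<leftarrow>es. [:- e, 1:])) = proots [:- e, 1:] + mset es"
        by (subst proots_mult) (auto simp: Cons)
      then show ?case by simp
    qed simp
    then show ?thesis by (simp add: cp)
  qed
  then have "eigval R k = ls ! (k - 1)" for k
    by (simp add: eigval_def ls_def flip: mset_map)
  then show ?thesis
    using that[of ls] cp' len by (simp add: ls_def sorted_wrt_rev)
qed

lemma eigval_antimono:
  assumes "hermitian_mat R" "R \<in> carrier_mat n n" "1 \<le> k" "k \<le> l" "l \<le> n"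
  shows "eigval R l \<le> eigval R k"
proof -
  obtain ls where "length ls = n" "sorted_wrt (\<ge>) ls" "\<And>k. eigval R k = ls ! (k - 1)"
    using ex_real_spectrum_list[OF assms(1,2)] by metis
  then show ?thesis using assms(3-) by (cases "k = l") (auto simp: sorted_wrt_iff_nth_less)
qed

lemma eigenvalue_iff_eigval:
  assumes "hermitian_mat R" "R \<in> carrier_mat n n"
  shows "eigenvalue R e \<longleftrightarrow> (\<exists>k\<in>{1..n}. e = of_real (eigval R k))"
proof -
  obtain ls where ls: "length ls = n" "\<And>k. eigval R k = ls ! (k - 1)"
    and cp: "char_poly R = (\<Prod>e\<leftarrow>map complex_of_real ls. [:- e, 1:])"
    using ex_real_spectrum_list[OF assms(1,2)] by metis
  have "eigenvalue R e \<longleftrightarrow> e \<in> complex_of_real ` set ls"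
    unfolding eigenvalue_root_char_poly[OF assms(2)] cp by (auto simp: poly_prod_list prod_list_zero_iff)
  also have "\<dots> \<longleftrightarrow> (\<exists>i<n. e = of_real (ls ! i))" using ls(1) by (auto simp: in_set_conv_nth image_iff)
  also have "\<dots> \<longleftrightarrow> (\<exists>k\<in>{1..n}. e = of_real (eigval R k))"
  proof
    assume "\<exists>i<n. e = of_real (ls ! i)"
    then obtain i where "i < n" "e = of_real (ls ! i)" by blast
    then show "\<exists>k\<in>{1..n}. e = of_real (eigval R k)" by (intro bexI[of _ "Suc i"]) (auto simp: ls(2))
  next
    assume "\<exists>k\<in>{1..n}. e = of_real (eigval R k)"
    then obtain k where "1 \<le> k" "k \<le> n" "e = of_real (ls ! (k - 1))" by (auto simp: ls(2))
    then show "\<exists>i<n. e = of_real (ls ! i)" by (intro exI[of _ "k - 1"]) auto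
  qed
  finally show ?thesis .
qed

lemma mat_trace_mult_minv_eigval:
  assumes H: "hermitian_mat R" and R: "R \<in> carrier_mat n n"
    and nz: "\<And>k. 1 \<le> k \<Longrightarrow> k \<le> n \<Longrightarrow> \<beta> + \<gamma> * of_real (eigval R k) \<noteq> 0"
  shows "mat_trace (R * minv (\<beta> \<cdot>\<^sub>m 1\<^sub>m n + \<gamma> \<cdot>\<^sub>m R)) =
    (\<Sum>k=1..n. of_real (eigval R k) / (\<beta> + \<gamma> * of_real (eigval R k)))"
proof -
  obtain ls where ls: "length ls = n" "\<And>k. eigval R k = ls ! (k - 1)"
    and cp: "char_poly R = (\<Prod>e\<leftarrow>map complex_of_real ls. [:- e, 1:])"
    using ex_real_spectrum_list[OF assms(1,2)] by metis
  have nz': "\<beta> + \<gamma> * e \<noteq> 0" if e: "e \<in> set (map complex_of_real ls)" for e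
  proof -
    obtain i where "i < n" "e = of_real (ls ! i)" using e ls(1) by (auto simp: in_set_conv_nth image_iff)
    then show ?thesis using nz[of "Suc i"] by (simp add: ls(2))
  qed
  have "mat_trace (R * minv (\<beta> \<cdot>\<^sub>m 1\<^sub>m n + \<gamma> \<cdot>\<^sub>m R)) =
      (\<Sum>e\<leftarrow>map complex_of_real ls. e / (\<beta> + \<gamma> * e))"
    by (rule mat_trace_mult_minv[OF R cp nz'])
  also have "\<dots> = (\<Sum>i<n. of_real (ls ! i) / (\<beta> + \<gamma> * of_real (ls ! i)))"
    using ls(1) by (simp add: sum_list_sum_nth lessThan_atLeast0)
  also have "\<dots> = (\<Sum>k=1..n. of_real (eigval R k) / (\<beta> + \<gamma> * of_real (eigval R k)))"
    unfolding ls(2) by (rule sum.reindex_bij_witness[of _ "\<lambda>k. k - 1" Suc]) auto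
  finally show ?thesis .
qed

section \<open>The companion variable\<close>

lemma Im_one_over: "Im (1 / v) = - Im v / (norm v)\<^sup>2"
  by (simp add: Im_divide cmod_power2)

lemma Im_of_real_mult: "Im (of_real r * v) = r * Im v"
  by simp

locale finite_spectrum =
  fixes M :: nat and c :: real and lam :: "nat \<Rightarrow> real"
  assumes M: "M \<ge> 1" and c: "c > 0"
    and lam_pos: "1 \<le> k \<Longrightarrow> k \<le> M \<Longrightarrow> lam k > 0"
    and lam_antimono: "1 \<le> k \<Longrightarrow> k \<le> l \<Longrightarrow> l \<le> M \<Longrightarrow> lam l \<le> lam k"
begin

definition eigs :: "'a :: real_normed_field set" where
  "eigs = (\<lambda>k. of_real (lam k)) ` {1..M}"

definition q :: "'a :: real_normed_field \<Rightarrow> 'a" where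
  "q w = of_real (c / real M) * (\<Sum>k=1..M. of_real (lam k) * w / (of_real (lam k) - w))"

definition Phi :: "'a :: real_normed_field \<Rightarrow> 'a" where
  "Phi w = q w * (q w - w)"

text \<open>
  Real-valued on the whole plane; on the real axis it is the derivative of \<open>q\<close>.
\<close>

definition q_slope :: "'a :: real_normed_field \<Rightarrow> real" where
  "q_slope w = c / real M * (\<Sum>k=1..M. (lam k)\<^sup>2 / (norm (of_real (lam k) - w))\<^sup>2)"

text \<open>
  \<open>Im (Phi w) = Im w \<cdot> Phi_slope w\<close>, and on the real axis this is the derivative of \<open>Phi\<close>.
\<close>

definition Phi_slope :: "complex \<Rightarrow> real" where
  "Phi_slope w = Re (q w) * (q_slope w - 1) + Re (q w - w) * q_slope w"

lemma cM_pos: "c / real M > 0"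
  using c M by simp

lemma notin_eigs: "w \<notin> eigs \<Longrightarrow> 1 \<le> k \<Longrightarrow> k \<le> M \<Longrightarrow> of_real (lam k) - w \<noteq> 0"
  by (auto simp: eigs_def)

lemma of_real_in_eigs_iff: "of_real x \<in> (eigs :: 'a :: real_normed_field set) \<longleftrightarrow> x \<in> eigs"
  by (auto simp: eigs_def)

lemma finite_eigs: "finite eigs" by (simp add: eigs_def)

lemma open_compl_eigs: "open (- (eigs :: 'a :: real_normed_field set))"
  by (simp add: finite_eigs finite_imp_closed open_Compl)

lemma Im_nonzero_notin_eigs: "Im w \<noteq> 0 \<Longrightarrow> w \<notin> eigs"
  by (auto simp: eigs_def)

lemma eigs_bounds: "x \<in> (eigs :: real set) \<Longrightarrow> lam M \<le> x \<and> x \<le> lam 1"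
  using lam_antimono M by (auto simp: eigs_def)

lemma q_of_real: "q (of_real x) = of_real (q x)"
  by (simp add: q_def)

lemma Phi_of_real: "Phi (of_real x) = of_real (Phi x)"
  by (simp add: Phi_def q_of_real)

lemma q_slope_of_real: "q_slope (of_real x :: 'a :: real_normed_field) = q_slope x"
  unfolding q_slope_def by (simp flip: of_real_diff)

lemma q_slope_real: "q_slope (x::real) = c / real M * (\<Sum>k=1..M. (lam k)\<^sup>2 / (lam k - x)\<^sup>2)"
  by (simp add: q_slope_def)

lemma Re_of_real_diff: "Re (complex_of_real a - complex_of_real b) = a - b"
  by simp

lemma Phi_slope_of_real: "Phi_slope (of_real x) = q x * (q_slope x - 1) + (q x - x) * q_slope x"
  unfolding Phi_slope_def q_of_real q_slope_of_real Re_of_real_diff by simp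

lemma q_slope_pos:
  assumes "w \<notin> eigs"
  shows "q_slope w > 0"
proof -
  have "(lam k)\<^sup>2 / (norm (of_real (lam k) - w))\<^sup>2 > 0" if "k \<in> {1..M}" for k
    using lam_pos[of k] notin_eigs[OF assms, of k] that by auto
  then have "(\<Sum>k=1..M. (lam k)\<^sup>2 / (norm (of_real (lam k) - w))\<^sup>2) > 0"
    using M by (intro sum_pos) auto
  then show ?thesis unfolding q_slope_def by (rule mult_pos_pos[OF cM_pos])
qed

lemma Im_q:
  assumes "w \<notin> eigs"
  shows "Im (q w) = Im w * q_slope w"
proof -
  have *: "Im (of_real (lam k) * w / (of_real (lam k) - w)) =
      Im w * ((lam k)\<^sup>2 / (norm (of_real (lam k) - w))\<^sup>2)" if "k \<in> {1..M}" for k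
  proof -
    have "of_real (lam k) * w / (of_real (lam k) - w) =
        of_real ((lam k)\<^sup>2) * (1 / (of_real (lam k) - w)) - of_real (lam k)"
      using notin_eigs[OF assms, of k] that by (simp add: field_simps power2_eq_square)
    then show ?thesis by (simp only: minus_complex.sel Im_of_real_mult Im_one_over) simp
  qed
  have "Im (q w) = c / real M * (\<Sum>k=1..M. Im (of_real (lam k) * w / (of_real (lam k) - w)))"
    unfolding q_def Im_of_real_mult by (simp add: Im_sum)
  also have "\<dots> = c / real M * (\<Sum>k=1..M. Im w * ((lam k)\<^sup>2 / (norm (of_real (lam k) - w))\<^sup>2))"
    using * by simp
  also have "\<dots> = Im w * q_slope w" by (simp add: q_slope_def sum_distrib_left mult_ac)
  finally show ?thesis .
qed

lemma Im_Phi: "w \<notin> eigs \<Longrightarrow> Im (Phi w) = Im w * Phi_slope w"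
  by (simp add: Phi_def Phi_slope_def Im_q algebra_simps)

lemma q_has_real_derivative:
  assumes "x \<notin> (eigs :: real set)"
  shows "(q has_real_derivative q_slope x) (at x)"
proof -
  have "((\<lambda>w. lam k * w / (lam k - w)) has_real_derivative (lam k)\<^sup>2 / (lam k - x)\<^sup>2) (at x)"
    if "k \<in> {1..M}" for k
    using notin_eigs[OF assms, of k] that
    by (auto intro!: derivative_eq_intros simp: power2_eq_square field_simps)
  then show ?thesis
    unfolding q_def[abs_def] q_slope_real of_real_eq_id id_apply by (intro DERIV_cmult DERIV_sum)
qed

lemma Phi_has_real_derivative:
  assumes "x \<notin> (eigs :: real set)"
  shows "(Phi has_real_derivative Phi_slope (of_real x)) (at x)"
  unfolding Phi_def[abs_def] Phi_slope_of_real
  by (auto intro!: derivative_eq_intros q_has_real_derivative[OF assms] simp: algebra_simps)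

lemma continuous_q: "w \<notin> eigs \<Longrightarrow> isCont q w"
  unfolding q_def[abs_def] by (intro continuous_intros) (use notin_eigs in auto)

lemma continuous_Phi: "w \<notin> eigs \<Longrightarrow> isCont Phi w"
  unfolding Phi_def[abs_def] by (intro continuous_intros continuous_q)

lemma continuous_q_slope: "w \<notin> eigs \<Longrightarrow> isCont q_slope w"
  unfolding q_slope_def[abs_def] by (intro continuous_intros) (use notin_eigs in auto)

lemma continuous_Phi_slope: "w \<notin> eigs \<Longrightarrow> isCont Phi_slope w"
  unfolding Phi_slope_def[abs_def] by (intro isCont_Re continuous_intros continuous_q continuous_q_slope)

lemma holomorphic_Phi: "Phi holomorphic_on - eigs"
  unfolding Phi_def[abs_def] q_def[abs_def]
  by (intro holomorphic_intros) (use notin_eigs in auto)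

text \<open>
  The inequality \<open>q_slope w < 1\<close> is \<open>Im s > 0\<close> in disguise: \<open>q w - w = 1 / (c s)\<close>, and the
  imaginary part of the left-hand side is \<open>Im w (q_slope w - 1)\<close>.
\<close>

lemma companion_point:
  fixes z s :: complex
  assumes s: "Im s > 0" "Im (z * s) > 0" and eq: "q w = of_real c * z * s"
    and w: "w = of_real c * z * s - 1 / (of_real c * s)"
  shows "Im w > 0" "Phi w = z" "q_slope w < 1"
proof -
  have "s \<noteq> 0" using s by auto
  have neg: "Im (1 / (of_real c * s)) < 0"
    using s c \<open>s \<noteq> 0\<close> unfolding Im_one_over by (simp add: divide_neg_pos)
  have pos: "Im (of_real c * z * s) > 0" using s c by (simp add: mult.assoc)
  show "Im w > 0" using neg pos by (simp add: w)
  have diff: "q w - w = 1 / (of_real c * s)" by (simp add: eq) (simp add: w)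
  show "Phi w = z" using c \<open>s \<noteq> 0\<close> unfolding Phi_def diff by (simp add: eq)
  have "Im (q w - w) = Im w * (q_slope w - 1)"
    using Im_q[OF Im_nonzero_notin_eigs] \<open>Im w > 0\<close> by (simp add: algebra_simps)
  then have "Im w * (q_slope w - 1) < 0" using neg diff by simp
  then show "q_slope w < 1" using \<open>Im w > 0\<close> by (simp add: mult_less_0_iff)
qed

text \<open>
  Every point of the upper half plane with \<open>q_slope w < 1\<close> is the companion point of a solution. The
  last equation turns bounds on \<open>Im w\<close> into bounds on \<open>Im s\<close>.
\<close>

lemma companion_point_converse:
  fixes w :: complex
  assumes w: "Im w > 0" "q_slope w < 1" and s: "s = 1 / (of_real c * (q w - w))"
  shows "Im s > 0" "Im (Phi w * s) > 0" "q w = of_real c * Phi w * s"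
    "w = of_real c * Phi w * s - 1 / (of_real c * s)"
    "Im s = Im w * (1 - q_slope w) / (c * (norm (q w - w))\<^sup>2)"
proof -
  have ns: "w \<notin> eigs" using w by (intro Im_nonzero_notin_eigs) auto
  have Im_diff: "Im (q w - w) = Im w * (q_slope w - 1)"
    using Im_q[OF ns] by (simp add: algebra_simps)
  then have "Im (q w - w) < 0" using w by (simp add: mult_less_0_iff)
  then have nz: "q w - w \<noteq> 0" by auto
  show "q w = of_real c * Phi w * s" using nz c by (simp add: Phi_def s)
  then show "w = of_real c * Phi w * s - 1 / (of_real c * s)" using nz c by (simp add: s)
  have "Im s = - Im (q w - w) / (c * (norm (q w - w))\<^sup>2)"
  proof -
    have "s = of_real (1 / c) * (1 / (q w - w))" by (simp add: s)
    then show ?thesis by (simp only: Im_of_real_mult Im_one_over) simp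
  qed
  then show Im_s: "Im s = Im w * (1 - q_slope w) / (c * (norm (q w - w))\<^sup>2)"
    unfolding Im_diff by (simp add: algebra_simps)
  then show "Im s > 0" using w c nz by simp
  have "Phi w * s = q w / of_real c" using nz c by (simp add: Phi_def s)
  then show "Im (Phi w * s) > 0" using Im_q[OF ns] q_slope_pos[OF ns] w c by simp
qed

end

section \<open>Stieltjes transforms near the real line\<close>

lemma integrable_stieltjes_kernel:
  fixes \<nu> :: "real measure"
  assumes fin: "finite_measure \<nu>" and sets: "sets \<nu> = sets borel" and z: "Im z > 0"
  shows "integrable \<nu> (\<lambda>x. 1 / (of_real x - z))"
proof -
  interpret finite_measure \<nu> by fact
  have meas: "(\<lambda>x. 1 / (of_real x - z)) \<in> borel_measurable \<nu>"
    unfolding measurable_cong_sets[OF sets refl] by measurable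
  show ?thesis
  proof (rule integrable_const_bound[OF _ meas, of "1 / Im z"])
    have "norm (1 / (of_real x - z)) \<le> 1 / Im z" for x
    proof -
      have "Im z \<le> norm (of_real x - z)" using abs_Im_le_cmod[of "of_real x - z"] by simp
      then show ?thesis using z by (simp add: norm_divide divide_simps)
    qed
    then show "AE x in \<nu>. norm (1 / (of_real x - z)) \<le> 1 / Im z" by simp
  qed
qed

text \<open>
  On \<open>[x - y, x + y]\<close> the Poisson kernel \<open>y / ((l - x)\<^sup>2 + y\<^sup>2)\<close> is at least \<open>1 / (2 y)\<close>.
\<close>

lemma measure_interval_le_Im_stieltjes:
  fixes \<nu> :: "real measure"
  assumes fin: "finite_measure \<nu>" and sets: "sets \<nu> = sets borel" and y: "y > 0"
  shows "measure \<nu> {x - y..x + y} \<le> 2 * y * Im (stieltjes \<nu> (Complex x y))"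
proof -
  interpret finite_measure \<nu> by fact
  let ?f = "\<lambda>l. 1 / (of_real l - Complex x y)"
  have int: "integrable \<nu> ?f" using integrable_stieltjes_kernel[OF fin sets, of "Complex x y"] y by simp
  have [measurable]: "{x - y..x + y} \<in> sets \<nu>" by (simp add: sets)
  have Im: "Im (?f l) = y / ((l - x)\<^sup>2 + y\<^sup>2)" for l
    by (simp add: Im_one_over cmod_power2)
  have "measure \<nu> {x - y..x + y} = (LINT l|\<nu>. indicator {x - y..x + y} l)"
    by (simp add: sets)
  also have "\<dots> \<le> (LINT l|\<nu>. 2 * y * Im (?f l))"
  proof (rule integral_mono)
    show "integrable \<nu> (indicator {x - y..x + y} :: real \<Rightarrow> real)"
      by (simp add: sets emeasure_finite less_top[symmetric])
    show "integrable \<nu> (\<lambda>l. 2 * y * Im (?f l))" using int by (intro integrable_mult_right integrable_Im)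
    show "indicator {x - y..x + y} l \<le> 2 * y * Im (?f l)" for l
    proof (cases "l \<in> {x - y..x + y}")
      case True
      then have "(l - x)\<^sup>2 \<le> y\<^sup>2" using y by (intro abs_le_square_iff[THEN iffD1]) auto
      then have "(l - x)\<^sup>2 + y\<^sup>2 \<le> 2 * y * y" by (simp add: power2_eq_square)
      moreover have "(l - x)\<^sup>2 + y\<^sup>2 > 0" using y by (simp add: add_nonneg_pos)
      ultimately show ?thesis using True unfolding Im by (simp add: field_simps)
    next
      case False
      then show ?thesis using y unfolding Im by simp
    qed
  qed
  also have "\<dots> = 2 * y * Im (stieltjes \<nu> (Complex x y))"
    using int by (simp add: stieltjes_def integral_Im)
  finally show ?thesis .
qed

text \<open>
  About \<open>(b - a) / y\<close> intervals of half-length \<open>y\<close> cover \<open>[a, b]\<close>, so the total mass is of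
  order \<open>y\<close>, for every small \<open>y\<close>.
\<close>

lemma measure_null_if_quadratically_small:
  fixes \<nu> :: "real measure"
  assumes fin: "finite_measure \<nu>" and sets: "sets \<nu> = sets borel" and ab: "a < b" and y0: "y0 > 0"
    and small: "\<And>x y. a \<le> x \<Longrightarrow> x \<le> b \<Longrightarrow> 0 < y \<Longrightarrow> y < y0 \<Longrightarrow> measure \<nu> {x - y..x + y} \<le> C * y\<^sup>2"
  shows "measure \<nu> {a..b} = 0"
proof -
  interpret finite_measure \<nu> by fact
  have bound: "measure \<nu> {a..b} \<le> real (n + 1) * (C * ((b - a) / real n)\<^sup>2)"
    if n: "n > 0" "(b - a) / real n < y0" for n :: nat
  proof -
    define y where "y = (b - a) / real n"
    have y: "0 < y" "y < y0" and ny: "real n * y = b - a" using n ab by (auto simp: y_def)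
    have cover: "{a..b} \<subseteq> (\<Union>i\<le>n. {(a + real i * y) - y..(a + real i * y) + y})"
    proof
      fix x assume x: "x \<in> {a..b}"
      define i where "i = nat \<lfloor>(x - a) / y\<rfloor>"
      have nonneg: "0 \<le> (x - a) / y" using x y by simp
      then have i: "real i \<le> (x - a) / y" "(x - a) / y < real i + 1"
        unfolding i_def by linarith+
      have "(x - a) / y \<le> real n" using x y ny by (simp add: divide_simps)
      then have "i \<le> n" using i(1) by linarith
      moreover have "real i * y \<le> x - a" "x - a \<le> real i * y + y"
        using i y by (auto simp: field_simps)
      ultimately show "x \<in> (\<Union>i\<le>n. {(a + real i * y) - y..(a + real i * y) + y})"
        using y by force
    qed
    have "measure \<nu> {a..b} \<le> measure \<nu> (\<Union>i\<le>n. {(a + real i * y) - y..(a + real i * y) + y})"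
      by (rule finite_measure_mono[OF cover]) (simp add: sets)
    also have "\<dots> \<le> (\<Sum>i\<le>n. measure \<nu> {(a + real i * y) - y..(a + real i * y) + y})"
      by (rule finite_measure_subadditive_finite) (auto simp: sets)
    also have "\<dots> \<le> (\<Sum>i\<le>n. C * y\<^sup>2)"
    proof (rule sum_mono)
      fix i assume "i \<in> {..n}"
      then have "real i * y \<le> real n * y" using y by simp
      then have "a \<le> a + real i * y" "a + real i * y \<le> b" using y ny by auto
      then show "measure \<nu> {(a + real i * y) - y..(a + real i * y) + y} \<le> C * y\<^sup>2"
        using small y by blast
    qed
    also have "\<dots> = real (n + 1) * (C * y\<^sup>2)" by simp
    finally show ?thesis by (simp add: y_def)
  qed
  have "(\<lambda>n. real (n + 1) / (real n)\<^sup>2) \<longlonglongrightarrow> 0" by real_asymp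
  then have "(\<lambda>n. C * (b - a)\<^sup>2 * (real (n + 1) / (real n)\<^sup>2)) \<longlonglongrightarrow> 0"
    by (rule tendsto_mult_right_zero)
  then have "(\<lambda>n. real (n + 1) * (C * ((b - a) / real n)\<^sup>2)) \<longlonglongrightarrow> 0"
    by (simp add: power_divide mult_ac)
  moreover have "\<forall>\<^sub>F n in sequentially. measure \<nu> {a..b} \<le> real (n + 1) * (C * ((b - a) / real n)\<^sup>2)"
  proof -
    have "(\<lambda>n. (b - a) / real n) \<longlonglongrightarrow> 0" by real_asymp
    then have "\<forall>\<^sub>F n in sequentially. (b - a) / real n < y0" using y0 by (rule order_tendstoD)
    with eventually_gt_at_top[of 0] show ?thesis by eventually_elim (rule bound)
  qed
  ultimately have "measure \<nu> {a..b} \<le> 0"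
    using tendsto_lowerbound[of _ 0 sequentially "measure \<nu> {a..b}"] by simp
  then show ?thesis using measure_nonneg[of \<nu> "{a..b}"] by simp
qed

text \<open>
  Away from the support the kernel \<open>1 / (l - z)\<close> is Lipschitz in \<open>z\<close>, uniformly in the relevant
  \<open>l\<close>. As \<open>T\<close> is real, the rate also bounds \<open>Im\<close> of the transform by a multiple of \<open>y\<close>.
\<close>

lemma stieltjes_boundary_value:
  fixes \<nu> :: "real measure"
  assumes fin: "finite_measure \<nu>" and sets: "sets \<nu> = sets borel" and x: "x \<notin> measure_support \<nu>"
  obtains T K where "K > 0" "\<And>y. y > 0 \<Longrightarrow> norm (stieltjes \<nu> (Complex x y) - of_real T) \<le> K * y"
    "T = (LINT l|\<nu>. 1 / (l - x))"
proof -
  interpret finite_measure \<nu> by fact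
  obtain U where U: "open U" "x \<in> U" "emeasure \<nu> U = 0"
    using x by (auto simp: measure_support_def not_less)
  then obtain d where d: "d > 0" "ball x d \<subseteq> U" by (auto simp: open_contains_ball)
  have "AE l in \<nu>. l \<notin> U" using U by (intro AE_not_in) (auto simp: null_sets_def sets)
  then have far: "AE l in \<nu>. d \<le> \<bar>l - x\<bar>"
    by eventually_elim (use d in \<open>force simp: dist_real_def subset_eq\<close>)
  have meas: "(\<lambda>l. 1 / (l - x)) \<in> borel_measurable \<nu>"
    unfolding measurable_cong_sets[OF sets refl] by measurable
  have intT: "integrable \<nu> (\<lambda>l. 1 / (l - x))"
  proof (rule integrable_const_bound[OF _ meas, of "1 / d"])
    show "AE l in \<nu>. norm (1 / (l - x)) \<le> 1 / d"
      using far by eventually_elim (use d in \<open>simp add: frac_le\<close>)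
  qed
  define T where "T = (LINT l|\<nu>. 1 / (l - x))"
  define K where "K = measure \<nu> (space \<nu>) / d\<^sup>2 + 1"
  have "K > 0" unfolding K_def by (intro add_nonneg_pos) (auto simp: d)
  moreover have "norm (stieltjes \<nu> (Complex x y) - of_real T) \<le> K * y" if y: "y > 0" for y
  proof -
    let ?f = "\<lambda>l. 1 / (of_real l - Complex x y)" and ?g = "\<lambda>l. complex_of_real (1 / (l - x))"
    have int: "integrable \<nu> ?f" using integrable_stieltjes_kernel[OF fin sets, of "Complex x y"] y by simp
    have intg: "integrable \<nu> ?g" using intT by (rule integrable_of_real)
    have "stieltjes \<nu> (Complex x y) - of_real T = (LINT l|\<nu>. ?f l - ?g l)"
      using int intg by (simp add: stieltjes_def T_def Bochner_Integration.integral_diff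
          flip: integral_complex_of_real)
    also have "norm \<dots> \<le> (LINT l|\<nu>. norm (?f l - ?g l))" by (rule integral_norm_bound)
    also have "\<dots> \<le> (LINT l|\<nu>. y / d\<^sup>2)"
    proof (rule integral_mono_AE)
      show "integrable \<nu> (\<lambda>l. norm (?f l - ?g l))" using int intg by (intro integrable_norm Bochner_Integration.integrable_diff)
      show "integrable \<nu> (\<lambda>l. y / d\<^sup>2)" by simp
      show "AE l in \<nu>. norm (?f l - ?g l) \<le> y / d\<^sup>2"
        using far
      proof eventually_elim
        case (elim l)
        let ?v = "of_real l - Complex x y"
        have Re: "\<bar>l - x\<bar> \<le> norm ?v" using abs_Re_le_cmod[of ?v] by simp
        have nz: "?v \<noteq> 0" "l - x \<noteq> 0" using elim d y by (auto simp: complex_eq_iff)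
        have "?f l - ?g l = (of_real (l - x) - ?v) / (?v * of_real (l - x))"
          using nz by (simp add: diff_frac_eq del: of_real_diff)
        also have "of_real (l - x) - ?v = \<i> * of_real y" by (simp add: complex_eq_iff)
        finally have "norm (?f l - ?g l) = y / (norm ?v * \<bar>l - x\<bar>)"
          using y by (simp add: norm_divide norm_mult del: of_real_diff)
        also have "\<dots> \<le> y / d\<^sup>2" unfolding power2_eq_square
          using Re elim d y by (intro divide_left_mono mult_mono mult_pos_pos) auto
        finally show ?case .
      qed
    qed
    also have "\<dots> = measure \<nu> (space \<nu>) / d\<^sup>2 * y" by simp
    also have "\<dots> \<le> K * y" using y by (simp add: K_def algebra_simps)
    finally show ?thesis .
  qed
  ultimately show ?thesis using that T_def by blast
qed

section \<open>Points outside the support and increasing branches\<close>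

text \<open>
  In \<open>t_iff\<close> the canonical equation is already written in the companion variable, so that matrices
  no longer occur.
\<close>

locale spectral_law = finite_spectrum +
  fixes t :: "complex \<Rightarrow> complex" and \<nu> :: "real measure"
  assumes t_iff: "Im z > 0 \<Longrightarrow>
      (Im s > 0 \<and> Im (z * s) > 0 \<and> q (of_real c * z * s - 1 / (of_real c * s)) = of_real c * z * s)
      \<longleftrightarrow> s = t z"
    and fin: "finite_measure \<nu>" and sets: "sets \<nu> = sets borel"
    and carrier: "emeasure \<nu> {..<0} = 0"
    and t_stieltjes: "Im z > 0 \<Longrightarrow> t z = stieltjes \<nu> z"
begin

lemma solution_t:
  assumes "Im z > 0"
  shows "Im (t z) > 0" "Im (z * t z) > 0"
    "q (of_real c * z * t z - 1 / (of_real c * t z)) = of_real c * z * t z"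
  using t_iff[OF assms, of "t z"] by auto

text \<open>
  Near \<open>w0\<close> the conditions \<open>q_slope w < 1\<close> and \<open>Phi_slope w > \<beta> > 0\<close> persist, so that
  \<open>Im z = Im w \<cdot> Phi_slope w\<close> controls \<open>Im w\<close> by \<open>Im z\<close>. Open mapping supplies, for each \<open>z\<close>
  near \<open>Phi w0\<close>, such a \<open>w\<close>; uniqueness of the canonical solution identifies it as the companion
  point of \<open>z\<close>. Hence \<open>Im (t z) = O(Im z)\<close> and the measure is quadratically small on intervals.
\<close>

lemma null_interval_if_increasing_branch:
  assumes w0: "w0 \<notin> (eigs :: real set)" and q: "q w0 < 0" "q w0 - w0 < 0" and Phi_slope: "Phi_slope (of_real w0) > 0"
  obtains r where "r > 0" "emeasure \<nu> {Phi w0 - r<..<Phi w0 + r} = 0"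
proof -
  interpret finite_measure \<nu> by (rule fin)
  let ?w0 = "complex_of_real w0"
  define \<beta> where "\<beta> = Phi_slope ?w0 / 2"
  define \<kappa> where "\<kappa> = norm (q ?w0 - ?w0) / 2"
  have ns: "?w0 \<notin> eigs" using w0 by (simp add: of_real_in_eigs_iff)
  have "q_slope w0 < 1"
  proof -
    have "(q w0 - w0) * q_slope w0 < 0" using q q_slope_pos[OF w0] by (intro mult_neg_pos)
    then have "q w0 * (q_slope w0 - 1) > 0" using Phi_slope by (simp add: Phi_slope_of_real)
    then show ?thesis using q by (simp add: zero_less_mult_iff)
  qed
  then have Dlt: "q_slope ?w0 < 1" by (simp add: q_slope_of_real)
  have \<beta>: "0 < \<beta>" "\<beta> < Phi_slope ?w0" using Phi_slope by (auto simp: \<beta>_def)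
  have "q ?w0 - ?w0 = of_real (q w0 - w0)" by (simp add: q_of_real)
  then have "q ?w0 - ?w0 \<noteq> 0" using q by (metis of_real_eq_0_iff less_irrefl)
  then have \<kappa>: "0 < \<kappa>" "\<kappa> < norm (q ?w0 - ?w0)" by (auto simp: \<kappa>_def)
  have lim: "(Phi_slope \<longlongrightarrow> Phi_slope ?w0) (nhds ?w0)" "(q_slope \<longlongrightarrow> q_slope ?w0) (nhds ?w0)" "(q \<longlongrightarrow> q ?w0) (nhds ?w0)"
    using continuous_Phi_slope[OF ns] continuous_q_slope[OF ns] continuous_q[OF ns] by (auto simp: isCont_def tendsto_at_iff_tendsto_nhds)
  have "\<forall>\<^sub>F w in nhds ?w0. w \<in> - eigs \<and> \<beta> < Phi_slope w \<and> q_slope w < 1 \<and> \<kappa> < norm (q w - w)"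
    using eventually_nhds_in_open[OF open_compl_eigs, of ?w0] ns
      order_tendstoD(1)[OF lim(1) \<beta>(2)] order_tendstoD(2)[OF lim(2) Dlt]
      order_tendstoD(1)[OF tendsto_norm[OF tendsto_diff[OF lim(3) filterlim_ident]] \<kappa>(2)]
    by (auto elim!: eventually_elim2 intro!: eventually_conj)
  then obtain e where e: "e > 0"
    and near: "\<And>w. dist w ?w0 < e \<Longrightarrow> w \<notin> eigs \<and> \<beta> < Phi_slope w \<and> q_slope w < 1 \<and> \<kappa> < norm (q w - w)"
    unfolding eventually_nhds_metric by auto
  define U where "U = ball ?w0 e"
  have U: "open U" "connected U" "U \<subseteq> - eigs" "?w0 \<in> U"
    using near e by (auto simp: U_def dist_commute)
  have "\<not> Phi constant_on U"
  proof
    assume "Phi constant_on U"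
    then have eq: "Phi w = Phi ?w0" if "w \<in> U" for w using U(4) that by (auto simp: constant_on_def)
    \<comment> \<open>On the vertical line through \<open>w0\<close> the imaginary part of \<open>Phi\<close> does not vanish.\<close>
    define w where "w = ?w0 + \<i> * of_real (e / 2)"
    have w: "dist w ?w0 < e" "Im w > 0" using e by (auto simp: w_def dist_norm norm_mult)
    then have "Im (Phi w) > 0" using near[OF w(1)] \<beta> Im_Phi[of w] by simp
    moreover have "w \<in> U" using w by (simp add: U_def dist_commute)
    ultimately show False using eq[of w] by (simp add: Phi_of_real)
  qed
  then have "open (Phi ` U)"
    using holomorphic_on_subset[OF holomorphic_Phi U(3)] U by (intro open_mapping_thm[of Phi U]) auto
  moreover have "of_real (Phi w0) \<in> Phi ` U" using U(4) by (metis Phi_of_real image_eqI)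
  ultimately obtain r0 where r0: "r0 > 0" "ball (of_real (Phi w0)) r0 \<subseteq> Phi ` U"
    by (meson open_contains_ball)
  define r where "r = r0 / 2"
  have r: "r > 0" using r0 by (simp add: r_def)
  have small: "measure \<nu> {x - y..x + y} \<le> 2 / (\<beta> * (c * \<kappa>\<^sup>2)) * y\<^sup>2"
    if x: "Phi w0 - r \<le> x" "x \<le> Phi w0 + r" and y: "0 < y" "y < r" for x y
  proof -
    have "dist (of_real (Phi w0)) (Complex x y) \<le> \<bar>Phi w0 - x\<bar> + \<bar>y\<bar>"
      using cmod_le[of "of_real (Phi w0) - Complex x y"] by (simp add: dist_norm)
    also have "\<dots> < r0" using x y by (simp add: r_def)
    finally obtain w where w: "w \<in> U" "Phi w = Complex x y" using r0(2) by (force simp: subset_eq image_iff)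
    then have nw: "w \<notin> eigs" "\<beta> < Phi_slope w" "q_slope w < 1" "\<kappa> < norm (q w - w)"
      using near[of w] by (auto simp: U_def dist_commute)
    have y_eq: "y = Im w * Phi_slope w" using Im_Phi[OF nw(1)] w by simp
    then have Im_w: "Im w > 0" using y nw(2) \<beta> by (auto simp: zero_less_mult_iff)
    then have "Im w * \<beta> \<le> y" using nw(2) unfolding y_eq by (intro mult_left_mono) auto
    then have Im_w_le: "Im w \<le> y / \<beta>" using \<beta> by (simp add: field_simps)
    define s where "s = 1 / (of_real c * (q w - w))"
    note s = companion_point_converse[OF Im_w nw(3) s_def]
    have "s = t (Complex x y)"
      using s(1-4) w(2) y t_iff[of "Complex x y" s] by (metis complex.sel(2))
    then have "Im (stieltjes \<nu> (Complex x y)) = Im w * (1 - q_slope w) / (c * (norm (q w - w))\<^sup>2)"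
      using s(5) t_stieltjes[of "Complex x y"] y by simp
    also have "\<dots> \<le> (y / \<beta>) * 1 / (c * \<kappa>\<^sup>2)"
      using Im_w Im_w_le nw q_slope_pos[OF nw(1)] c \<kappa> y \<beta>
      by (intro frac_le mult_mono mult_left_mono power_mono mult_pos_pos) auto
    finally have "Im (stieltjes \<nu> (Complex x y)) \<le> y / (\<beta> * (c * \<kappa>\<^sup>2))" by simp
    then have "2 * y * Im (stieltjes \<nu> (Complex x y)) \<le> 2 * y * (y / (\<beta> * (c * \<kappa>\<^sup>2)))"
      using y by (intro mult_left_mono) auto
    then show ?thesis
      using measure_interval_le_Im_stieltjes[OF fin sets y(1), of x] by (simp add: power2_eq_square)
  qed
  have "measure \<nu> {Phi w0 - r..Phi w0 + r} = 0"
    using measure_null_if_quadratically_small[OF fin sets _ r small] r by simp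
  then have "emeasure \<nu> {Phi w0 - r..Phi w0 + r} = 0" by (simp add: emeasure_eq_measure)
  moreover have "emeasure \<nu> {Phi w0 - r<..<Phi w0 + r} \<le> emeasure \<nu> {Phi w0 - r..Phi w0 + r}"
    by (intro emeasure_mono) (auto simp: sets)
  ultimately show ?thesis using that[OF r] by simp
qed

lemma increasing_branch_outside_support:
  assumes "w0 \<notin> (eigs :: real set)" "q w0 < 0" "q w0 - w0 < 0" "Phi_slope (of_real w0) > 0"
  shows "Phi w0 \<notin> measure_support \<nu>"
proof -
  obtain r where r: "r > 0" "emeasure \<nu> {Phi w0 - r<..<Phi w0 + r} = 0"
    using null_interval_if_increasing_branch[OF assms] .
  then have "open {Phi w0 - r<..<Phi w0 + r} \<and> Phi w0 \<in> {Phi w0 - r<..<Phi w0 + r}" by auto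
  then show ?thesis using r(2) unfolding measure_support_def by (metis (mono_tags, lifting) less_irrefl mem_Collect_eq)
qed

lemma negative_outside_support:
  assumes "x < 0"
  shows "x \<notin> measure_support \<nu>"
  using assms carrier unfolding measure_support_def
  by (metis (mono_tags, lifting) less_irrefl mem_Collect_eq open_lessThan lessThan_iff)

text \<open>
  The boundary value \<open>T\<close> of \<open>t\<close> cannot vanish: if it did, \<open>w\<close> would tend to infinity, where
  \<open>q(w) = c z t(z)\<close> tends to the nonzero number \<open>- (c/M) \<Sum> \<lambda>\<^sub>k\<close>. Nonvanishing is what makes
  \<open>1 / (c t)\<close>, and with it the companion variable, bounded, with \<open>Im w = O(y)\<close>.
\<close>

lemma companion_boundary_value:
  assumes x: "x \<notin> measure_support \<nu>"
  obtains T where "T \<noteq> 0" "T = (LINT l|\<nu>. 1 / (l - x))"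
    "((\<lambda>y. t (Complex x y)) \<longlongrightarrow> of_real T) (at_right 0)"
    "\<exists>K>0. \<forall>\<^sub>F y in at_right 0.
       Im (of_real c * Complex x y * t (Complex x y) - 1 / (of_real c * t (Complex x y))) \<le> K * y"
proof -
  obtain T K where K: "K > 0" and T: "T = (LINT l|\<nu>. 1 / (l - x))"
    and rate: "\<And>y. y > 0 \<Longrightarrow> norm (stieltjes \<nu> (Complex x y) - of_real T) \<le> K * y"
    using stieltjes_boundary_value[OF fin sets x] by metis
  define s where "s y = t (Complex x y)" for y
  define z where "z y = Complex x y" for y
  have pos: "\<forall>\<^sub>F y in at_right (0::real). y > 0" by (simp add: eventually_at_right_less)
  have rate': "norm (s y - of_real T) \<le> K * y" if "y > 0" for y
    using rate[OF that] t_stieltjes[of "Complex x y"] that by (simp add: s_def)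
  have s_lim: "(s \<longlongrightarrow> of_real T) (at_right 0)"
  proof -
    have "((\<lambda>y. K * y) \<longlongrightarrow> 0) (at_right 0)" by (auto intro!: tendsto_eq_intros)
    then have "((\<lambda>y. s y - of_real T) \<longlongrightarrow> 0) (at_right 0)"
      by (rule Lim_null_comparison[rotated]) (use pos rate' in \<open>auto elim!: eventually_mono\<close>)
    then show ?thesis by (simp add: LIM_zero_iff)
  qed
  have z_lim: "(z \<longlongrightarrow> of_real x) (at_right 0)"
    unfolding z_def[abs_def] complex_of_real_def by (intro tendsto_Complex tendsto_ident_at tendsto_const)
  have sol: "Im (s y) > 0" "Im (z y * s y) > 0"
    "q (of_real c * z y * s y - 1 / (of_real c * s y)) = of_real c * z y * s y" if "y > 0" for y
    using solution_t[of "Complex x y"] that by (auto simp: s_def z_def)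
  have "T \<noteq> 0"
  proof
    assume "T = 0"
    then have s0: "(s \<longlongrightarrow> 0) (at_right 0)" using s_lim by simp
    \<comment> \<open>\<open>u = 1 / w\<close>, which stays meaningful in the limit \<open>t \<rightarrow> 0\<close>.\<close>
    define u where "u y = of_real c * s y / ((of_real c)\<^sup>2 * z y * (s y)\<^sup>2 - 1)" for y
    have "(u \<longlongrightarrow> of_real c * 0 / ((of_real c)\<^sup>2 * of_real x * 0\<^sup>2 - 1)) (at_right 0)"
      unfolding u_def[abs_def] by (intro tendsto_intros s0 z_lim) simp
    then have u0: "(u \<longlongrightarrow> 0) (at_right 0)" by simp
    have eq: "of_real c * z y * s y =
        of_real (c / real M) * (\<Sum>k=1..M. of_real (lam k) / (of_real (lam k) * u y - 1))"
      if "y > 0" for y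
    proof -
      let ?w = "of_real c * z y * s y - 1 / (of_real c * s y)"
      have sn: "s y \<noteq> 0" using sol(1)[OF that] by auto
      have w: "Im ?w > 0" using companion_point(1)[OF sol[OF that] refl] .
      then have wn: "?w \<noteq> 0" by (metis less_irrefl zero_complex.sel(2))
      have "?w = ((of_real c)\<^sup>2 * z y * (s y)\<^sup>2 - 1) / (of_real c * s y)"
        using sn c by (simp add: field_simps power2_eq_square)
      then have u: "u y = 1 / ?w" by (simp add: u_def)
      have "of_real (lam k) * ?w / (of_real (lam k) - ?w) = of_real (lam k) / (of_real (lam k) * u y - 1)"
        for k
        unfolding u using wn by (metis (no_types, lifting) diff_divide_distrib divide_divide_eq_right divide_self mult.right_neutral times_divide_eq_right)
      then show ?thesis using sol(3)[OF that] unfolding q_def by simp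
    qed
    let ?A = "complex_of_real (c / real M) * (\<Sum>k=1..M. of_real (lam k) / (of_real (lam k) * 0 - 1))"
    have lim1: "((\<lambda>y. of_real c * z y * s y) \<longlongrightarrow> of_real c * of_real x * 0) (at_right 0)"
      by (intro tendsto_intros s0 z_lim)
    have "((\<lambda>y. of_real (c / real M) * (\<Sum>k=1..M. of_real (lam k) / (of_real (lam k) * u y - 1)))
        \<longlongrightarrow> ?A) (at_right 0)"
      by (intro tendsto_intros u0) simp
    then have "((\<lambda>y. of_real c * z y * s y) \<longlongrightarrow> ?A) (at_right 0)"
      by (rule Lim_transform_eventually) (use pos eq in \<open>auto elim!: eventually_mono\<close>)
    with lim1 have A0: "?A = 0" using tendsto_unique[OF trivial_limit_at_right_real] by fastforce
    have "?A = - of_real (c / real M * (\<Sum>k=1..M. lam k))" by (simp add: sum_negf)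
    then have "complex_of_real (c / real M * (\<Sum>k=1..M. lam k)) = 0"
      unfolding A0 by (simp only: neg_equal_0_iff_equal zero_eq_1_divide_iff neg_0_equal_iff_equal)
    then have "c / real M * (\<Sum>k=1..M. lam k) = 0" using of_real_eq_0_iff by blast
    moreover have "(\<Sum>k=1..M. lam k) > 0" using M lam_pos by (intro sum_pos) auto
    ultimately show False using mult_pos_pos[OF cM_pos] by fastforce
  qed
  define L where "L = \<bar>T\<bar> / 2"
  have L: "0 < L" "L < norm (complex_of_real T)" using \<open>T \<noteq> 0\<close> by (auto simp: L_def)
  define K' where "K' = c * (\<bar>x\<bar> * K + (\<bar>T\<bar> + 1)) + K / (c * L\<^sup>2)"
  have "K' > 0" unfolding K'_def using c K L by (intro add_pos_pos mult_pos_pos divide_pos_pos add_nonneg_pos) auto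
  moreover have "\<forall>\<^sub>F y in at_right 0.
      Im (of_real c * Complex x y * t (Complex x y) - 1 / (of_real c * t (Complex x y))) \<le> K' * y"
  proof -
    have "\<forall>\<^sub>F y in at_right 0. L < norm (s y)"
      using order_tendstoD(1)[OF tendsto_norm[OF s_lim] L(2)] .
    moreover have "\<forall>\<^sub>F y in at_right 0. norm (s y) < \<bar>T\<bar> + 1"
      by (rule order_tendstoD(2)[OF tendsto_norm[OF s_lim]]) simp
    ultimately show ?thesis using pos
    proof eventually_elim
      case (elim y)
      have "\<bar>Im (s y - of_real T)\<bar> \<le> K * y" using rate'[OF elim(3)] abs_Im_le_cmod order_trans by blast
      then have Im_s: "Im (s y) \<le> K * y" by simp
      have "Im (z y * s y) = x * Im (s y) + y * Re (s y)" by (simp add: z_def)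
      also have "\<dots> \<le> \<bar>x\<bar> * (K * y) + y * (\<bar>T\<bar> + 1)"
      proof (rule add_mono)
        show "x * Im (s y) \<le> \<bar>x\<bar> * (K * y)"
          using Im_s sol(1)[OF elim(3)] by (intro mult_mono) auto
        show "y * Re (s y) \<le> y * (\<bar>T\<bar> + 1)"
          using elim complex_Re_le_cmod[of "s y"] by (intro mult_left_mono) auto
      qed
      finally have 1: "Im (of_real c * (z y * s y)) \<le> c * (\<bar>x\<bar> * (K * y) + y * (\<bar>T\<bar> + 1))"
        using c unfolding Im_of_real_mult by (intro mult_left_mono) auto
      have "1 / (of_real c * s y) = of_real (1 / c) * (1 / s y)" by simp
      then have "- Im (1 / (of_real c * s y)) = 1 / c * (Im (s y) / (norm (s y))\<^sup>2)"
        by (simp only: Im_of_real_mult Im_one_over minus_mult_right minus_divide_left minus_minus)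
      also have "\<dots> \<le> 1 / c * ((K * y) / L\<^sup>2)"
        using c L elim Im_s K sol(1)[OF elim(3)]
        by (intro mult_left_mono frac_le power_mono) auto
      finally have 2: "- Im (1 / (of_real c * s y)) \<le> K * y / (c * L\<^sup>2)" by simp
      have "Im (of_real c * (z y * s y) - 1 / (of_real c * s y)) \<le> K' * y"
        using 1 2 by (simp add: K'_def algebra_simps)
      then show ?case by (simp add: z_def s_def mult.assoc)
    qed
  qed
  ultimately show ?thesis using that[of T] \<open>T \<noteq> 0\<close> T s_lim unfolding s_def by blast
qed

end

section \<open>The branches of the inverse on the real line\<close>

lemma pos_on_interval_if_nonzero:
  fixes f :: "real \<Rightarrow> real"
  assumes S: "connected S" "continuous_on S f" "\<And>x. x \<in> S \<Longrightarrow> f x \<noteq> 0"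
    and "x \<in> S" "f x > 0" "y \<in> S"
  shows "f y > 0"
proof (rule ccontr)
  assume "\<not> f y > 0"
  moreover have "connected (f ` S)" using S(2,1) by (rule connected_continuous_image)
  ultimately have "0 \<in> f ` S"
    using connectedD_interval[of "f ` S" "f y" "f x" 0] assms(4-) by simp
  then obtain z where "z \<in> S" "f z = 0" by (metis imageE)
  then show False using S(3) by blast
qed

context finite_spectrum
begin

text \<open>
  The normalized trace \<open>(1/M) Tr R (R - w I)\<^sup>-\<^sup>1\<close>, in terms of the eigenvalues.
\<close>

definition mres :: "real \<Rightarrow> real" where
  "mres w = 1 / real M * (\<Sum>k=1..M. lam k / (lam k - w))"

text \<open>
  \<open>- q_inf\<close> is the limit of \<open>q\<close> at infinity.
\<close>

definition q_inf :: real where "q_inf = c / real M * (\<Sum>k=1..M. lam k)"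

lemma q_inf_pos: "q_inf > 0"
  unfolding q_inf_def by (intro mult_pos_pos cM_pos sum_pos) (use M lam_pos in auto)

lemma lam1_pos: "lam 1 > 0" and lamM_pos: "lam M > 0"
  using lam_pos M by auto

lemma le_lam1: "1 \<le> k \<Longrightarrow> k \<le> M \<Longrightarrow> lam k \<le> lam 1"
  and lamM_le: "1 \<le> k \<Longrightarrow> k \<le> M \<Longrightarrow> lam M \<le> lam k"
  using lam_antimono by auto

lemma notin_eigs_outside: "w < lam M \<or> lam 1 < w \<Longrightarrow> w \<notin> (eigs :: real set)"
  using eigs_bounds[of w] by auto

lemma q_eq_mres: "q w = c * w * mres w"
  by (simp add: q_def mres_def sum_distrib_left mult_ac)

lemma Phi_eq_mres: "Phi w = c * w\<^sup>2 * mres w * (c * mres w - 1)"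
  by (simp add: Phi_def q_eq_mres algebra_simps power2_eq_square)

lemma q_right_le:
  assumes "w > lam 1"
  shows "q w \<le> - q_inf"
proof -
  have "lam k * w / (lam k - w) \<le> - lam k" if "k \<in> {1..M}" for k
    using assms le_lam1[of k] lam_pos[of k] that by (simp add: field_simps)
  then have "(\<Sum>k=1..M. lam k * w / (lam k - w)) \<le> (\<Sum>k=1..M. - lam k)" by (rule sum_mono)
  then have "c / real M * (\<Sum>k=1..M. lam k * w / (lam k - w)) \<le> c / real M * (\<Sum>k=1..M. - lam k)"
    using cM_pos by (intro mult_left_mono) auto
  then show ?thesis by (simp add: q_def q_inf_def sum_negf)
qed

lemma q_right_le_pole:
  assumes "w > lam 1"
  shows "q w \<le> - (c / real M * (lam 1)\<^sup>2 / (w - lam 1))"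
proof -
  have neg: "lam k * w / (lam k - w) \<le> 0" if "k \<in> {1..M}" for k
    using assms le_lam1[of k] lam_pos[of k] that by (simp add: divide_simps)
  have "(\<Sum>k=1..M. lam k * w / (lam k - w)) = lam 1 * w / (lam 1 - w) + (\<Sum>k\<in>{1..M}-{1}. lam k * w / (lam k - w))"
    using M by (subst sum.remove[of _ 1]) auto
  also have "(\<Sum>k\<in>{1..M}-{1}. lam k * w / (lam k - w)) \<le> 0"
    using neg by (intro sum_nonpos) auto
  also have "lam 1 * w / (lam 1 - w) + 0 \<le> - ((lam 1)\<^sup>2 / (w - lam 1))"
  proof -
    have "(lam 1)\<^sup>2 / (w - lam 1) \<le> lam 1 * w / (w - lam 1)"
      using assms lam1_pos unfolding power2_eq_square by (intro divide_right_mono mult_left_mono) auto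
    moreover have "lam 1 * w / (lam 1 - w) = - (lam 1 * w / (w - lam 1))"
      using minus_divide_right[of "lam 1 * w" "w - lam 1"] by simp
    ultimately show ?thesis by simp
  qed
  finally have "c / real M * (\<Sum>k=1..M. lam k * w / (lam k - w)) \<le> c / real M * - ((lam 1)\<^sup>2 / (w - lam 1))"
    using cM_pos by (intro mult_left_mono) auto
  then show ?thesis by (simp add: q_def)
qed

lemma q_left_bounds:
  assumes "w < 0"
  shows "- q_inf < q w" "q w < 0"
proof -
  have bounds: "- lam k < lam k * w / (lam k - w) \<and> lam k * w / (lam k - w) < 0" if "k \<in> {1..M}" for k
    using assms lam_pos[of k] that by (auto simp: field_simps mult_less_0_iff)
  have "(\<Sum>k=1..M. - lam k) < (\<Sum>k=1..M. lam k * w / (lam k - w))"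
    using bounds M by (intro sum_strict_mono) auto
  then have "c / real M * (\<Sum>k=1..M. - lam k) < c / real M * (\<Sum>k=1..M. lam k * w / (lam k - w))"
    using cM_pos by (intro mult_strict_left_mono)
  then show "- q_inf < q w" by (simp add: q_def q_inf_def sum_negf)
  have "(\<Sum>k=1..M. lam k * w / (lam k - w)) < (\<Sum>k=1..M. 0)"
    using bounds M by (intro sum_strict_mono) auto
  then have "c / real M * (\<Sum>k=1..M. lam k * w / (lam k - w)) < 0"
    using cM_pos by (intro mult_pos_neg) auto
  then show "q w < 0" by (simp add: q_def)
qed

lemma Phi_right:
  assumes "w > lam 1"
  shows "(q w)\<^sup>2 < Phi w" "q_inf * w \<le> Phi w" "q_inf\<^sup>2 < Phi w" "q w < 0" "q w - w < 0"
proof -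
  have w: "w > 0" using assms lam1_pos by simp
  have qA: "q_inf \<le> - q w" using q_right_le[OF assms] by simp
  show neg: "q w < 0" "q w - w < 0" using qA w q_inf_pos by auto
  have "Phi w = (q w)\<^sup>2 + (- q w) * w" by (simp add: Phi_def power2_eq_square algebra_simps)
  moreover have "q_inf * w \<le> (- q w) * w" using qA w by (intro mult_right_mono) auto
  moreover have "q_inf\<^sup>2 \<le> (- q w)\<^sup>2" using qA q_inf_pos by (intro power_mono) auto
  moreover have "(- q w)\<^sup>2 = (q w)\<^sup>2" "q_inf * w > 0" "(q w)\<^sup>2 > 0" using q_inf_pos w neg by auto
  ultimately show "(q w)\<^sup>2 < Phi w" "q_inf * w \<le> Phi w" "q_inf\<^sup>2 < Phi w" by linarith+
qed

text \<open>
  With \<open>p = - q > 0\<close> one has \<open>Phi w = p (p + w)\<close>. For \<open>w < 0\<close> both \<open>p < q_inf\<close> and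
  \<open>p + w < p\<close>; to the right of the spectrum both inequalities are reversed. So \<open>q_inf\<^sup>2\<close>
  separates the values.
\<close>

lemma Phi_left_less_Phi_right:
  assumes "v < 0" "w > lam 1"
  shows "Phi v < Phi w"
proof -
  have "Phi v = (q v)\<^sup>2 - q v * v" by (simp add: Phi_def power2_eq_square algebra_simps)
  moreover have "q v * v > 0" using q_left_bounds[OF assms(1)] assms(1) by (simp add: mult_neg_neg)
  moreover have "(- q v)\<^sup>2 \<le> q_inf\<^sup>2" using q_left_bounds[OF assms(1)] by (intro power_mono) auto
  ultimately show ?thesis using Phi_right(3)[OF assms(2)] by simp
qed

lemma mres_strict_mono:
  assumes "v < w" "w < lam M"
  shows "mres v < mres w"
proof -
  have "(\<Sum>k=1..M. lam k / (lam k - v)) < (\<Sum>k=1..M. lam k / (lam k - w))"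
    using M assms lamM_le lam_pos by (intro sum_strict_mono divide_strict_left_mono mult_pos_pos) force+
  then show ?thesis using M unfolding mres_def by (intro mult_strict_left_mono) auto
qed

lemma mres_0: "mres 0 = 1"
proof -
  have "(\<Sum>k=1..M. lam k / (lam k - 0)) = (\<Sum>k=1..M. 1)" using lam_pos by (intro sum.cong) force+
  then show ?thesis using M by (simp add: mres_def)
qed

lemma continuous_mres: "w \<notin> (eigs :: real set) \<Longrightarrow> isCont mres w"
  unfolding mres_def[abs_def] by (intro continuous_intros) (use notin_eigs in force)

lemma mres_negative_root:
  assumes "c > 1"
  obtains w where "w < 0" "mres w = 1 / c"
proof -
  have "(\<Sum>k=1..M. lam k / (lam k - (- q_inf))) \<le> (\<Sum>k=1..M. lam k / q_inf)"
    using lam_pos q_inf_pos by (intro sum_mono divide_left_mono mult_pos_pos add_pos_pos) force+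
  also have "\<dots> = real M / c"
  proof -
    have "(\<Sum>k=1..M. lam k) \<noteq> 0" using q_inf_pos unfolding q_inf_def by auto
    then show ?thesis using c M unfolding sum_divide_distrib[symmetric] q_inf_def by simp
  qed
  finally have "mres (- q_inf) \<le> 1 / c" using M by (simp add: mres_def field_simps)
  moreover have "1 / c < mres 0" using assms by (simp add: mres_0)
  moreover have "\<forall>x. - q_inf \<le> x \<and> x \<le> 0 \<longrightarrow> isCont mres x"
    using lamM_pos by (auto intro!: continuous_mres notin_eigs_outside)
  ultimately obtain w where "- q_inf \<le> w" "w \<le> 0" "mres w = 1 / c"
    using IVT[of mres "- q_inf" "1 / c" 0] q_inf_pos by auto
  moreover have "w \<noteq> 0" using \<open>mres w = 1 / c\<close> \<open>1 / c < mres 0\<close> by auto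
  ultimately show ?thesis using that[of w] by simp
qed

text \<open>
  For \<open>w\<close> between 0 and the smallest eigenvalue each \<open>\<lambda>\<^sub>k / (\<lambda>\<^sub>k - w)\<close> exceeds 1, hence is dominated by its square.
\<close>

lemma q_slope_gt_1_below_spectrum:
  assumes "0 < w" "w < lam M" "q w > w"
  shows "q_slope w > 1"
proof -
  have "lam k / (lam k - w) \<le> (lam k)\<^sup>2 / (lam k - w)\<^sup>2" if "k \<in> {1..M}" for k
  proof -
    have "1 \<le> lam k / (lam k - w)" using assms lamM_le[of k] that by (simp add: field_simps)
    then have "lam k / (lam k - w) * 1 \<le> lam k / (lam k - w) * (lam k / (lam k - w))"
      by (intro mult_left_mono) auto
    then show ?thesis by (simp add: power2_eq_square)
  qed
  then have "(\<Sum>k=1..M. lam k / (lam k - w)) \<le> (\<Sum>k=1..M. (lam k)\<^sup>2 / (lam k - w)\<^sup>2)" by (rule sum_mono)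
  then have "c / real M * (\<Sum>k=1..M. lam k / (lam k - w)) \<le> q_slope w"
    unfolding q_slope_real using cM_pos by (intro mult_left_mono) auto
  moreover have "c / real M * (\<Sum>k=1..M. lam k / (lam k - w)) = q w / w"
    using assms by (simp add: q_eq_mres mres_def)
  moreover have "q w / w > 1" using assms by simp
  ultimately show ?thesis by simp
qed

text \<open>
  Between 0 and the smallest eigenvalue a positive value of \<open>Phi\<close> forces \<open>q w > w\<close>, hence
  \<open>q_slope w > 1\<close>. On the negative axis \<open>q < 0\<close>, so \<open>Phi w > 0\<close> forces \<open>q w < w\<close>, that is
  \<open>c \<cdot> mres w > 1\<close>; as \<open>mres < 1\<close> there, this needs \<open>c > 1\<close>.
\<close>

lemma branch_cases:
  assumes out: "w < lam M \<or> lam 1 < w" and q_slope: "q_slope w \<le> 1" and Phi: "Phi w > 0"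
  obtains "lam 1 < w" | "w < 0" "mres w > 1 / c" "c > 1"
proof (cases "lam 1 < w")
  case False
  then have w: "w < lam M" using out by simp
  consider "w = 0" | "w > 0" | "w < 0" by linarith
  then have "w < 0 \<and> q w - w < 0"
  proof cases
    case 1
    then show ?thesis using Phi by (simp add: Phi_def q_def)
  next
    case 2
    have "lam k * w / (lam k - w) > 0" if "k \<in> {1..M}" for k
      using 2 w lamM_le[of k] lam_pos[of k] that by simp
    then have "(\<Sum>k=1..M. lam k * w / (lam k - w)) > 0" using M by (intro sum_pos) auto
    then have "q w > 0" unfolding q_def of_real_eq_id id_apply using cM_pos by (rule mult_pos_pos[rotated])
    then have "q w > w" using Phi by (simp add: Phi_def zero_less_mult_iff)
    then show ?thesis using q_slope_gt_1_below_spectrum[OF 2 w] q_slope by simp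
  next
    case 3
    then show ?thesis using q_left_bounds(2)[OF 3] Phi by (simp add: Phi_def zero_less_mult_iff)
  qed
  then have neg: "w < 0" "w * (c * mres w - 1) < 0" by (auto simp: q_eq_mres algebra_simps)
  then have "mres w > 1 / c" using c by (simp add: mult_less_0_iff field_simps)
  moreover have "mres w < 1" using mres_strict_mono[of w 0] neg lamM_pos by (simp add: mres_0)
  ultimately have "c > 1" using c by (smt (verit) divide_le_eq_1_pos le_divide_eq_1_pos)
  then show ?thesis using that(2) neg \<open>mres w > 1 / c\<close> by blast
qed (rule that(1))

lemma Phi_slope_zero_iff: "w \<notin> eigs \<Longrightarrow> Phi_slope (of_real w) = 0 \<longleftrightarrow> (Phi has_real_derivative 0) (at w)"
  using Phi_has_real_derivative[of w] by (auto dest: DERIV_unique)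

lemma continuous_on_Phi_slope: "S \<inter> eigs = {} \<Longrightarrow> continuous_on S (\<lambda>w. Phi_slope (of_real w))"
  unfolding Phi_slope_of_real
proof (intro continuous_at_imp_continuous_on ballI continuous_intros)
qed (auto intro!: continuous_q continuous_q_slope)

lemma MVT_Phi:
  fixes u v :: real
  assumes "u < v" "{u..v} \<inter> eigs = {}"
  obtains x where "u < x" "x < v" "Phi v - Phi u = (v - u) * Phi_slope (of_real x)"
proof -
  have "(Phi has_real_derivative Phi_slope (of_real x)) (at x)" if "u \<le> x" "x \<le> v" for x
    using assms that by (intro Phi_has_real_derivative) (auto simp: disjoint_iff)
  from MVT2[OF assms(1) this] show ?thesis using that by blast
qed

lemma IVT_Phi:
  fixes u v :: real
  assumes "u \<le> v" "{u..v} \<inter> eigs = {}" "Phi u \<le> x" "x \<le> Phi v"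
  obtains w where "u \<le> w" "w \<le> v" "Phi w = x"
proof -
  have "\<forall>y. u \<le> y \<and> y \<le> v \<longrightarrow> isCont Phi y"
    using assms by (auto simp: disjoint_iff intro!: continuous_Phi)
  from IVT[OF assms(3,4,1) this] show ?thesis using that by blast
qed

text \<open>
  The derivative has one zero \<open>p\<close> on the half-line, hence a constant sign on either side. These signs
  are found by the mean value theorem from the growth of \<open>Phi\<close> at the pole \<open>lam 1\<close> and at
  infinity.
\<close>

lemma upper_edge:
  assumes crit: "\<And>v. v > lam 1 \<and> Phi_slope (of_real v) = 0 \<longleftrightarrow> v = p"
  shows "p > lam 1"
    and "\<And>w. w > lam 1 \<Longrightarrow> Phi_slope (of_real w) > 0 \<Longrightarrow> Phi w > Phi p"
    and "\<And>x. x > Phi p \<Longrightarrow> \<exists>w > lam 1. Phi w = x \<and> Phi_slope (of_real w) > 0"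
proof -
  show p: "p > lam 1" using crit[of p] by simp
  have Bp: "Phi_slope (of_real p) = 0" using crit[of p] by simp
  have nz: "Phi_slope (of_real v) \<noteq> 0" if "v > lam 1" "v \<noteq> p" for v using crit[of v] that by metis
  have disj: "S \<inter> eigs = {}" if "S \<subseteq> {lam 1<..}" for S :: "real set"
    using that notin_eigs_outside by (auto simp: disjoint_iff subset_eq)
  have large: "\<exists>v>p. Phi v > y" for y
  proof -
    define v where "v = max (p + 1) ((y + 1) / q_inf)"
    have "y + 1 \<le> q_inf * v" using q_inf_pos by (simp add: v_def field_simps max_def)
    moreover have "q_inf * v \<le> Phi v" using p by (intro Phi_right) (simp add: v_def)
    ultimately show ?thesis by (intro exI[of _ v]) (auto simp: v_def)
  qed
  have right: "Phi_slope (of_real w) > 0" if "w > p" for w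
  proof -
    obtain v where v: "v > p" "Phi v > Phi p" using large by blast
    have "{p..v} \<inter> eigs = {}" using p by (intro disj) auto
    from MVT_Phi[OF v(1) this] obtain x
      where x: "p < x" "x < v" "Phi v - Phi p = (v - p) * Phi_slope (of_real x)" .
    then have "(v - p) * Phi_slope (of_real x) > 0" using v by simp
    then have Bx: "Phi_slope (of_real x) > 0" using v by (simp add: zero_less_mult_iff)
    have cont: "continuous_on {p<..} (\<lambda>w. Phi_slope (of_real w))"
      using p by (intro continuous_on_Phi_slope disj) auto
    show ?thesis
      by (rule pos_on_interval_if_nonzero[where S = "{p<..}" and x = x and f = "\<lambda>w. Phi_slope (of_real w)"])
        (use that x(1) p nz Bx cont in auto)
  qed
  have left: "Phi_slope (of_real w) < 0" if "lam 1 < w" "w < p" for w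
  proof -
    define K where "K = c / real M * (lam 1)\<^sup>2"
    have K: "K > 0" unfolding K_def using cM_pos lam1_pos by (intro mult_pos_pos) auto
    have Phip: "Phi p > 0" using Phi_right(3)[OF p] by (smt (verit) zero_le_power2)
    \<comment> \<open>Close enough to the pole that \<open>- q v \<ge> 1 + Phi p\<close>, and left of \<open>p\<close>.\<close>
    define d where "d = min ((p - lam 1) / 2) (K / (1 + Phi p))"
    define v where "v = lam 1 + d"
    have d: "d > 0" "d \<le> (p - lam 1) / 2" "d \<le> K / (1 + Phi p)"
      unfolding d_def using p K Phip by (auto simp: min_def)
    have v: "lam 1 < v" "v < p" using d p by (auto simp: v_def)
    have "1 + Phi p \<le> K / d" using d K Phip by (simp add: field_simps)
    also have "\<dots> \<le> - q v" using q_right_le_pole[OF v(1)] by (simp add: K_def v_def)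
    finally have "(1 + Phi p)\<^sup>2 \<le> (- q v)\<^sup>2" using Phip by (intro power_mono) auto
    moreover have "Phi p < (1 + Phi p)\<^sup>2" using Phip by (simp add: power2_eq_square algebra_simps add_pos_pos)
    ultimately have Phiv: "Phi p < Phi v" using Phi_right(1)[OF v(1)] by simp
    have "{v..p} \<inter> eigs = {}" using v by (intro disj) auto
    from MVT_Phi[OF v(2) this] obtain x
      where x: "v < x" "x < p" "Phi p - Phi v = (p - v) * Phi_slope (of_real x)" .
    then have "(p - v) * Phi_slope (of_real x) < 0" using Phiv by simp
    then have Bx: "Phi_slope (of_real x) < 0" using v by (simp add: mult_less_0_iff)
    have cont: "continuous_on {lam 1<..<p} (\<lambda>w. - Phi_slope (of_real w))"
      by (intro continuous_on_minus continuous_on_Phi_slope disj) auto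
    have "- Phi_slope (of_real w) > 0"
      by (rule pos_on_interval_if_nonzero[where S = "{lam 1<..<p}" and x = x and f = "\<lambda>w. - Phi_slope (of_real w)"])
        (use that x(1,2) v nz Bx cont in auto)
    then show ?thesis by simp
  qed
  have incr: "Phi w > Phi p" if w: "w > p" for w
  proof -
    have "{p..w} \<inter> eigs = {}" using p by (intro disj) auto
    from MVT_Phi[OF w this] obtain x
      where x: "p < x" "x < w" "Phi w - Phi p = (w - p) * Phi_slope (of_real x)" .
    then have "(w - p) * Phi_slope (of_real x) > 0" using right[OF x(1)] w by simp
    then show ?thesis using x(3) by simp
  qed
  show "Phi w > Phi p" if "w > lam 1" "Phi_slope (of_real w) > 0" for w
    using incr left[of w] that Bp by (cases w p rule: linorder_cases) auto
  show "\<exists>w > lam 1. Phi w = x \<and> Phi_slope (of_real w) > 0" if x: "x > Phi p" for x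
  proof -
    obtain v where v: "v > p" "Phi v > x" using large by blast
    have "{p..v} \<inter> eigs = {}" using p by (intro disj) auto
    from IVT_Phi[OF less_imp_le[OF v(1)] this less_imp_le[OF x] less_imp_le[OF v(2)]]
    obtain w where w: "p \<le> w" "w \<le> v" "Phi w = x" .
    then have "w > p" using x by (cases "w = p") auto
    then show ?thesis using right w p by (intro exI[of _ w]) auto
  qed
qed

text \<open>
  Here \<open>Phi\<close> vanishes at both ends of the interval and is positive inside, so its only critical
  point is a maximum.
\<close>

lemma lower_edge:
  assumes \<omega>: "\<omega> < 0" "mres \<omega> = 1 / c" and crit: "\<And>v. \<omega> < v \<and> v < 0 \<and> Phi_slope (of_real v) = 0 \<longleftrightarrow> v = p"
  shows "\<omega> < p" "p < 0" "Phi p > 0"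
    and "\<And>w. \<omega> < w \<Longrightarrow> w < 0 \<Longrightarrow> q w < 0 \<and> q w - w < 0"
    and "\<And>w. \<omega> < w \<Longrightarrow> w < 0 \<Longrightarrow> Phi_slope (of_real w) > 0 \<Longrightarrow> Phi w < Phi p"
    and "\<And>x. 0 < x \<Longrightarrow> x < Phi p \<Longrightarrow> \<exists>w. \<omega> < w \<and> w < 0 \<and> Phi w = x \<and> Phi_slope (of_real w) > 0"
proof -
  show p: "\<omega> < p" "p < 0" using crit[of p] by simp_all
  have Bp: "Phi_slope (of_real p) = 0" using crit[of p] by simp
  have nz: "Phi_slope (of_real v) \<noteq> 0" if "\<omega> < v" "v < 0" "v \<noteq> p" for v using crit[of v] that by metis
  have disj: "S \<inter> eigs = {}" if "S \<subseteq> {..0}" for S :: "real set"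
  proof -
    have "x \<notin> eigs" if "x \<in> S" for x
      using that \<open>S \<subseteq> {..0}\<close> lamM_pos by (intro notin_eigs_outside) auto
    then show ?thesis by blast
  qed
  show neg: "q w < 0 \<and> q w - w < 0" if "\<omega> < w" "w < 0" for w
  proof
    show "q w < 0" using q_left_bounds[OF that(2)] by simp
    have "mres w > 1 / c" using mres_strict_mono[of \<omega> w] that lamM_pos \<omega>(2) by simp
    then have "c * mres w - 1 > 0" using c by (simp add: field_simps)
    then have "w * (c * mres w - 1) < 0" using that by (simp add: mult_neg_pos)
    then show "q w - w < 0" by (simp add: q_eq_mres algebra_simps)
  qed
  have Phi_pos: "Phi w > 0" if "\<omega> < w" "w < 0" for w
    using neg[OF that] by (simp add: Phi_def mult_neg_neg)
  show "Phi p > 0" using Phi_pos p by blast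
  have "Phi \<omega> = 0" using \<omega> c by (simp add: Phi_eq_mres)
  have "Phi (0 :: real) = 0" by (simp add: Phi_def q_def)
  have left: "Phi_slope (of_real w) > 0" if "\<omega> < w" "w < p" for w
  proof -
    have "{\<omega>..p} \<inter> eigs = {}" using p by (intro disj) auto
    from MVT_Phi[OF p(1) this] obtain x
      where x: "\<omega> < x" "x < p" "Phi p - Phi \<omega> = (p - \<omega>) * Phi_slope (of_real x)" .
    then have "(p - \<omega>) * Phi_slope (of_real x) > 0" using Phi_pos[OF p] \<open>Phi \<omega> = 0\<close> by simp
    then have Bx: "Phi_slope (of_real x) > 0" using p by (simp add: zero_less_mult_iff)
    have cont: "continuous_on {\<omega><..<p} (\<lambda>w. Phi_slope (of_real w))"
      using p by (intro continuous_on_Phi_slope disj) auto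
    show ?thesis
      by (rule pos_on_interval_if_nonzero[where S = "{\<omega><..<p}" and x = x and f = "\<lambda>w. Phi_slope (of_real w)"])
        (use that x(1,2) p nz Bx cont in auto)
  qed
  have right: "Phi_slope (of_real w) < 0" if "p < w" "w < 0" for w
  proof -
    have "{p..0} \<inter> eigs = {}" by (intro disj) auto
    from MVT_Phi[OF p(2) this] obtain x
      where x: "p < x" "x < 0" "Phi 0 - Phi p = (0 - p) * Phi_slope (of_real x)" .
    then have "(0 - p) * Phi_slope (of_real x) < 0" using Phi_pos[OF p] \<open>Phi (0 :: real) = 0\<close> by simp
    then have Bx: "Phi_slope (of_real x) < 0" using p by (simp add: zero_less_mult_iff)
    have cont: "continuous_on {p<..<0} (\<lambda>w. - Phi_slope (of_real w))"
      by (intro continuous_on_minus continuous_on_Phi_slope disj) auto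
    have "- Phi_slope (of_real w) > 0"
      by (rule pos_on_interval_if_nonzero[where S = "{p<..<0}" and x = x and f = "\<lambda>w. - Phi_slope (of_real w)"])
        (use that x(1,2) p nz Bx cont in auto)
    then show ?thesis by simp
  qed
  have incr: "Phi w < Phi p" if w: "\<omega> < w" "w < p" for w
  proof -
    have "{w..p} \<inter> eigs = {}" using p by (intro disj) auto
    from MVT_Phi[OF w(2) this] obtain x
      where x: "w < x" "x < p" "Phi p - Phi w = (p - w) * Phi_slope (of_real x)" .
    then have "(p - w) * Phi_slope (of_real x) > 0" using left[of x] x(1,2) w by simp
    then show ?thesis using x(3) by simp
  qed
  show "Phi w < Phi p" if "\<omega> < w" "w < 0" "Phi_slope (of_real w) > 0" for w
    using incr right[of w] that Bp by (cases w p rule: linorder_cases) auto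
  show "\<exists>w. \<omega> < w \<and> w < 0 \<and> Phi w = x \<and> Phi_slope (of_real w) > 0" if x: "0 < x" "x < Phi p" for x
  proof -
    have "{\<omega>..p} \<inter> eigs = {}" using p by (intro disj) auto
    moreover have "\<omega> \<le> p" "Phi \<omega> \<le> x" "x \<le> Phi p" using p x \<open>Phi \<omega> = 0\<close> by auto
    ultimately obtain w where w: "\<omega> \<le> w" "w \<le> p" "Phi w = x"
      using IVT_Phi[of \<omega> p x] by blast
    have "w \<noteq> \<omega>" "w \<noteq> p" using w x \<open>Phi \<omega> = 0\<close> by auto
    with w have "\<omega> < w" "w < p" by auto
    then show ?thesis using left w p by (intro exI[of _ w]) auto
  qed
qed

end

section \<open>A dense spectrum repels the companion variable\<close>

text \<open>
  The terms up to \<open>k\<close> are \<open>1/k, \<dots>, 1\<close> and contribute \<open>harm k\<close> after reversal; those beyond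
  \<open>k\<close> dominate \<open>1/j\<close> termwise.
\<close>

lemma sum_inverse_distance_ge_harm:
  fixes M k :: nat
  assumes "1 \<le> k" "k \<le> M"
  shows "harm M \<le> (\<Sum>j=1..M. if j \<le> k then 1 / real (k + 1 - j) else 1 / real (j - k))"
    (is "_ \<le> sum ?f _")
proof -
  have split: "{1..M} = {1..k} \<union> {k<..M}" "{1..k} \<inter> {k<..M} = {}" using assms by auto
  have "(harm M :: real) = (\<Sum>j=1..k. 1 / real j) + (\<Sum>j\<in>{k<..M}. 1 / real j)"
    unfolding harm_def split(1) by (subst sum.union_disjoint) (auto simp: divide_inverse)
  also have "(\<Sum>j=1..k. 1 / real j) = (\<Sum>j=1..k. ?f j)"
    by (rule sum.reindex_bij_witness[of _ "\<lambda>j. k + 1 - j" "\<lambda>j. k + 1 - j"]) auto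
  also have "(\<Sum>j\<in>{k<..M}. 1 / real j) \<le> (\<Sum>j\<in>{k<..M}. ?f j)"
    using assms by (intro sum_mono) (auto simp: frac_le)
  finally show ?thesis unfolding split(1) by (subst sum.union_disjoint) auto
qed

context finite_spectrum
begin

text \<open>
  Let \<open>k\<close> be the last index with \<open>w0 \<le> lam k\<close>. Counting positions from the gap between \<open>k\<close>
  and \<open>k + 1\<close>, the spacing condition bounds the distance from \<open>w0\<close> to the eigenvalue at position
  \<open>i\<close> by \<open>\<kappa> (i/M)\<^sup>1\<^sup>/\<^sup>2\<close>. Moving from \<open>w0\<close> to \<open>w\<close> at most doubles this bound, so the sum in
  \<open>q_slope w\<close> is at least \<open>c a\<^sup>2 / (4 \<kappa>\<^sup>2)\<close> times a harmonic number.
\<close>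

lemma q_slope_ge_1_near_spectrum:
  assumes a: "a > 0" "\<And>k. 1 \<le> k \<Longrightarrow> k \<le> M \<Longrightarrow> a \<le> lam k" and \<kappa>: "\<kappa> > 0"
    and spacing: "\<And>k l. 1 \<le> k \<Longrightarrow> k \<le> l \<Longrightarrow> l \<le> M \<Longrightarrow>
      \<bar>lam k - lam l\<bar> \<le> \<kappa> * sqrt (\<bar>real k - real l\<bar> / real M)"
    and large: "4 * \<kappa>\<^sup>2 / (c * a\<^sup>2) \<le> harm M"
    and w0: "lam M \<le> w0" "w0 \<le> lam 1" and w: "norm (w - of_real w0) \<le> \<kappa> / sqrt (real M)" "w \<notin> eigs"
  shows "q_slope w \<ge> 1"
proof -
  define k where "k = Max {i \<in> {1..M}. w0 \<le> lam i}"
  have fin: "finite {i \<in> {1..M}. w0 \<le> lam i}" and ne: "{i \<in> {1..M}. w0 \<le> lam i} \<noteq> {}"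
    using w0 M by auto
  then have "k \<in> {i \<in> {1..M}. w0 \<le> lam i}" unfolding k_def by (rule Max_in)
  then have k: "1 \<le> k" "k \<le> M" "w0 \<le> lam k" by auto
  have below: "lam i < w0" if "k < i" "i \<le> M" for i
    using Max_ge[OF fin, of i] that k unfolding k_def[symmetric] by force
  define f where "f j = (if j \<le> k then 1 / real (k + 1 - j) else 1 / real (j - k))" for j
  have dist: "\<bar>lam j - w0\<bar> \<le> \<kappa> * sqrt (1 / (f j * real M))" if j: "1 \<le> j" "j \<le> M" for j
  proof (cases "j \<le> k")
    case True
    have w0j: "w0 \<le> lam j" using lam_antimono[of j k] j k True by simp
    have "lam j - w0 \<le> \<kappa> * sqrt (real (k + 1 - j) / real M)"
    proof (cases "k = M")
      case True
      then have "lam j - w0 \<le> \<bar>lam j - lam M\<bar>" using w0 by simp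
      also have "\<dots> \<le> \<kappa> * sqrt (\<bar>real j - real M\<bar> / real M)" using spacing[of j M] j by simp
      also have "\<dots> \<le> \<kappa> * sqrt (real (k + 1 - j) / real M)"
        using \<kappa> True j M by (intro mult_left_mono real_sqrt_le_mono divide_right_mono) auto
      finally show ?thesis .
    next
      case False
      then have "lam j - w0 \<le> \<bar>lam j - lam (k + 1)\<bar>" using below[of "k + 1"] k by simp
      also have "\<dots> \<le> \<kappa> * sqrt (\<bar>real j - real (k + 1)\<bar> / real M)"
        using spacing[of j "k + 1"] j k True False by simp
      also have "\<dots> \<le> \<kappa> * sqrt (real (k + 1 - j) / real M)"
        using \<kappa> True j M by (intro mult_left_mono real_sqrt_le_mono divide_right_mono) auto
      finally show ?thesis .
    qed
    then show ?thesis using w0j True by (simp add: f_def)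
  next
    case False
    then have "\<bar>lam j - w0\<bar> \<le> \<bar>lam k - lam j\<bar>" using below[of j] j k by simp
    also have "\<dots> \<le> \<kappa> * sqrt (\<bar>real k - real j\<bar> / real M)" using spacing[of k j] False j k by simp
    also have "\<bar>real k - real j\<bar> = real (j - k)" using False by simp
    finally show ?thesis using False by (simp add: f_def)
  qed
  have bounds: "a\<^sup>2 / (4 * \<kappa>\<^sup>2) * real M * f j \<le> (lam j)\<^sup>2 / (norm (of_real (lam j) - w))\<^sup>2"
    if j: "1 \<le> j" "j \<le> M" for j
  proof -
    have f: "0 < f j" "f j \<le> 1" using j by (auto simp: f_def)
    define r where "r = \<kappa> * sqrt (1 / (f j * real M))"
    have r: "r > 0" "r\<^sup>2 = \<kappa>\<^sup>2 / (f j * real M)"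
      using \<kappa> f M by (auto simp: r_def power_mult_distrib)
    have "\<kappa> / sqrt (real M) = \<kappa> * sqrt (1 / real M)" by (simp add: real_sqrt_divide)
    also have "\<dots> \<le> r" unfolding r_def
      using \<kappa> f M by (intro mult_left_mono real_sqrt_le_mono divide_left_mono mult_pos_pos) (auto simp: mult_le_cancel_right1)
    finally have wr: "norm (w - of_real w0) \<le> r" using w by simp
    have "norm (of_real (lam j) - w) \<le> norm (of_real (lam j - w0) :: 'a) + norm (w - of_real w0)"
      using norm_triangle_ineq4[of "of_real (lam j - w0)" "w - of_real w0"] by simp
    also have "norm (of_real (lam j - w0) :: 'a) = \<bar>lam j - w0\<bar>" by (rule norm_of_real)
    finally have le: "norm (of_real (lam j) - w) \<le> 2 * r" using dist[OF j] wr by (simp add: r_def)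
    have "a\<^sup>2 / (4 * \<kappa>\<^sup>2) * real M * f j = a\<^sup>2 / (2 * r)\<^sup>2"
      using r f M \<kappa> by (simp add: power_mult_distrib)
    also have "\<dots> \<le> (lam j)\<^sup>2 / (norm (of_real (lam j) - w))\<^sup>2"
      using a j le r notin_eigs[OF w(2) j] by (intro frac_le power_mono) auto
    finally show ?thesis .
  qed
  have "1 \<le> c * a\<^sup>2 / (4 * \<kappa>\<^sup>2) * harm M"
    using large c a \<kappa> by (simp add: field_simps)
  also have "\<dots> \<le> c * a\<^sup>2 / (4 * \<kappa>\<^sup>2) * (\<Sum>j=1..M. f j)"
    using sum_inverse_distance_ge_harm[OF k(1,2)] c a \<kappa> by (intro mult_left_mono) (auto simp: f_def)
  also have "\<dots> = c / real M * (\<Sum>j=1..M. a\<^sup>2 / (4 * \<kappa>\<^sup>2) * real M * f j)"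
    using M by (simp only: sum_distrib_left[symmetric]) simp
  also have "\<dots> \<le> q_slope w" unfolding q_slope_def using bounds cM_pos by (intro mult_left_mono sum_mono) auto
  finally show ?thesis .
qed

end

section \<open>The support between the edges\<close>

lemma closed_measure_support:
  assumes "sets \<nu> = sets borel"
  shows "closed (measure_support \<nu>)"
proof -
  have "\<exists>U. open U \<and> x \<in> U \<and> U \<subseteq> - measure_support \<nu>" if "x \<in> - measure_support \<nu>" for x
    using that unfolding measure_support_def by blast
  then have "open (- measure_support \<nu>)" by (subst open_subopen) blast
  then show ?thesis by (simp add: closed_def)
qed

context spectral_law
begin

text \<open>
  The limit \<open>w0\<close> of the companion variable cannot lie in the convex hull of the spectrum, because
  \<open>q_slope < 1\<close> along the approach. Hence \<open>q\<close>, \<open>q_slope\<close> and \<open>Phi_slope\<close> are continuous at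
  \<open>w0\<close>. The derivative of \<open>Phi\<close> is positive there because \<open>y = Im w \<cdot> Phi_slope w\<close> while
  \<open>Im w = O(y)\<close>.
\<close>

lemma companion_real_point:
  assumes x: "x \<notin> measure_support \<nu>"
    and repel: "\<And>w0. lam M \<le> w0 \<Longrightarrow> w0 \<le> lam 1 \<Longrightarrow>
      \<exists>\<eta>>0. \<forall>w. Im w > 0 \<longrightarrow> norm (w - complex_of_real w0) < \<eta> \<longrightarrow> q_slope w \<ge> 1"
  obtains w0 T where "T \<noteq> 0" "T = (LINT l|\<nu>. 1 / (l - x))" "w0 = c * x * T - 1 / (c * T)"
    "w0 < lam M \<or> lam 1 < w0" "q w0 = c * x * T" "Phi w0 = x" "q_slope w0 \<le> 1" "Phi_slope (of_real w0) > 0"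
proof -
  from companion_boundary_value[OF x] obtain T
    where T: "T \<noteq> 0" "T = (LINT l|\<nu>. 1 / (l - x))"
    and t_lim: "((\<lambda>y. t (Complex x y)) \<longlongrightarrow> of_real T) (at_right 0)"
    and ex: "\<exists>K>0. \<forall>\<^sub>F y in at_right 0.
       Im (of_real c * Complex x y * t (Complex x y) - 1 / (of_real c * t (Complex x y))) \<le> K * y" .
  from ex obtain K where K: "K > 0"
    and Im_le: "\<forall>\<^sub>F y in at_right 0.
       Im (of_real c * Complex x y * t (Complex x y) - 1 / (of_real c * t (Complex x y))) \<le> K * y"
    by blast
  define z where "z y = Complex x y" for y
  define w where "w y = of_real c * z y * t (z y) - 1 / (of_real c * t (z y))" for y
  define w0 where "w0 = c * x * T - 1 / (c * T)"
  have pos: "\<forall>\<^sub>F y in at_right (0::real). y > 0" by (simp add: eventually_at_right_less)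
  have w: "Im (w y) > 0" "Phi (w y) = z y" "q_slope (w y) < 1" "q (w y) = of_real c * z y * t (z y)" if "y > 0" for y
  proof -
    have "Im (z y) > 0" using that by (simp add: z_def)
    note s = solution_t[OF this]
    show q: "q (w y) = of_real c * z y * t (z y)" using s(3) by (simp add: w_def)
    show "Im (w y) > 0" "Phi (w y) = z y" "q_slope (w y) < 1"
      using companion_point[OF s(1,2) q w_def] by simp_all
  qed
  have z_lim: "(z \<longlongrightarrow> of_real x) (at_right 0)"
    unfolding z_def[abs_def] complex_of_real_def by (intro tendsto_Complex tendsto_ident_at tendsto_const)
  have t_lim': "((\<lambda>y. t (z y)) \<longlongrightarrow> of_real T) (at_right 0)" using t_lim by (simp add: z_def)
  have "(w \<longlongrightarrow> of_real c * of_real x * of_real T - 1 / (of_real c * of_real T)) (at_right 0)"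
    unfolding w_def[abs_def] by (intro tendsto_intros z_lim t_lim') (use c T in auto)
  then have w_lim: "(w \<longlongrightarrow> of_real w0) (at_right 0)" by (simp add: w0_def)
  have out: "w0 < lam M \<or> lam 1 < w0"
  proof (rule ccontr)
    assume "\<not> (w0 < lam M \<or> lam 1 < w0)"
    then obtain \<eta> where \<eta>: "\<eta> > 0"
      and q_slope: "\<And>w. Im w > 0 \<Longrightarrow> norm (w - complex_of_real w0) < \<eta> \<Longrightarrow> q_slope w \<ge> 1"
      using repel[of w0] by auto
    have "\<forall>\<^sub>F y in at_right 0. dist (w y) (of_real w0) < \<eta>" using w_lim \<eta> by (rule tendstoD)
    with pos have "\<forall>\<^sub>F y in at_right (0::real). False"
    proof eventually_elim
      case (elim y)
      then show ?case using q_slope[of "w y"] w(1,3)[of y] by (simp add: dist_norm)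
    qed
    then show False by (simp add: trivial_limit_at_right_real eventually_False)
  qed
  then have ns: "complex_of_real w0 \<notin> eigs"
    using notin_eigs_outside of_real_in_eigs_iff by blast
  have "((\<lambda>y. q (w y)) \<longlongrightarrow> q (of_real w0)) (at_right 0)"
    by (rule isCont_tendsto_compose[OF continuous_q[OF ns] w_lim])
  moreover have "((\<lambda>y. q (w y)) \<longlongrightarrow> of_real c * of_real x * of_real T) (at_right 0)"
  proof (rule Lim_transform_eventually)
    show "((\<lambda>y. of_real c * z y * t (z y)) \<longlongrightarrow> of_real c * of_real x * of_real T) (at_right 0)"
      by (intro tendsto_intros z_lim t_lim')
    show "\<forall>\<^sub>F y in at_right 0. of_real c * z y * t (z y) = q (w y)"
      using pos by eventually_elim (simp add: w)
  qed
  ultimately have "q (complex_of_real w0) = of_real (c * x * T)"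
    using tendsto_unique[OF trivial_limit_at_right_real] by fastforce
  then have q: "q w0 = c * x * T" unfolding q_of_real of_real_eq_iff .
  have "q w0 - w0 = 1 / (c * T)" by (simp add: q) (simp add: w0_def)
  then have Phi: "Phi w0 = x" using q c T by (simp add: Phi_def)
  have "q_slope (complex_of_real w0) \<le> 1"
  proof (rule tendsto_upperbound)
    show "((\<lambda>y. q_slope (w y)) \<longlongrightarrow> q_slope (complex_of_real w0)) (at_right 0)"
      by (rule isCont_tendsto_compose[OF continuous_q_slope[OF ns] w_lim])
    show "\<forall>\<^sub>F y in at_right 0. q_slope (w y) \<le> 1" using pos by eventually_elim (use w(3) in force)
  qed simp
  then have q_slope: "q_slope w0 \<le> 1" by (simp add: q_slope_of_real)
  have "1 / K \<le> Phi_slope (of_real w0)"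
  proof (rule tendsto_lowerbound)
    show "((\<lambda>y. Phi_slope (w y)) \<longlongrightarrow> Phi_slope (of_real w0)) (at_right 0)"
      by (rule isCont_tendsto_compose[OF continuous_Phi_slope[OF ns] w_lim])
    show "\<forall>\<^sub>F y in at_right 0. 1 / K \<le> Phi_slope (w y)"
      using pos Im_le
    proof eventually_elim
      case (elim y)
      have "Im (w y) \<le> K * y" using elim(2) by (simp add: w_def z_def)
      have y_eq: "Im (w y) * Phi_slope (w y) = y"
        using Im_Phi[OF Im_nonzero_notin_eigs, of "w y"] w(1,2)[OF elim(1)] by (simp add: z_def)
      then have "0 < Im (w y) * Phi_slope (w y)" using elim(1) by simp
      then have "Phi_slope (w y) > 0" using w(1)[OF elim(1)] by (rule zero_less_mult_pos)
      then have "Im (w y) * Phi_slope (w y) \<le> (K * y) * Phi_slope (w y)"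
        using \<open>Im (w y) \<le> K * y\<close> by (intro mult_right_mono) auto
      then have "y \<le> (K * y) * Phi_slope (w y)" unfolding y_eq .
      then show "1 / K \<le> Phi_slope (w y)" using elim(1) K by (simp add: field_simps)
    qed
  qed simp
  then have "Phi_slope (of_real w0) > 0" using K by (smt (verit) zero_less_divide_1_iff)
  then show ?thesis using that[OF T w0_def out q Phi q_slope] by blast
qed

text \<open>
  At \<open>x = 0\<close> the limits reduce to \<open>w0 = - 1 / (c T)\<close> and \<open>q w0 = 0\<close>. The boundary value \<open>T\<close>
  is the integral of \<open>1 / l\<close>, which is positive, so \<open>w0\<close> lies on the negative axis, where
  \<open>q < 0\<close>.
\<close>

lemma zero_in_support:
  assumes repel: "\<And>w0. lam M \<le> w0 \<Longrightarrow> w0 \<le> lam 1 \<Longrightarrow>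
      \<exists>\<eta>>0. \<forall>w. Im w > 0 \<longrightarrow> norm (w - complex_of_real w0) < \<eta> \<longrightarrow> q_slope w \<ge> 1"
  shows "0 \<in> measure_support \<nu>"
proof (rule ccontr)
  assume "0 \<notin> measure_support \<nu>"
  from companion_real_point[OF this repel] obtain w0 T
    where T: "T \<noteq> 0" "T = (LINT l|\<nu>. 1 / (l - 0))" and w0: "w0 = c * 0 * T - 1 / (c * T)" "q w0 = c * 0 * T"
    by blast
  have "AE l in \<nu>. l \<notin> {..<0}"
    using carrier by (intro AE_not_in) (auto simp: null_sets_def sets)
  then have "AE l in \<nu>. 0 \<le> 1 / (l - 0)" by eventually_elim auto
  then have "T \<ge> 0" unfolding T(2) by (rule integral_nonneg_AE)
  then have "w0 < 0" using T(1) c by (simp add: w0)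
  then show False using q_left_bounds(2)[of w0] w0(2) by simp
qed

text \<open>
  A positive point outside the support is a value of \<open>Phi\<close> on an increasing outer branch, by
  \<open>repel\<close>, hence lies above \<open>Phi p\<close> or below \<open>Phi p'\<close>; such values are in turn outside the
  support. The endpoints follow because the support is closed.
\<close>

theorem support_eq:
  assumes repel: "\<And>w0. lam M \<le> w0 \<Longrightarrow> w0 \<le> lam 1 \<Longrightarrow>
      \<exists>\<eta>>0. \<forall>w. Im w > 0 \<longrightarrow> norm (w - complex_of_real w0) < \<eta> \<longrightarrow> q_slope w \<ge> 1"
    and p: "\<And>v. v > lam 1 \<and> Phi_slope (of_real v) = 0 \<longleftrightarrow> v = p"
    and \<omega>: "c > 1 \<Longrightarrow> \<omega> < 0 \<and> mres \<omega> = 1 / c"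
    and p': "\<And>v. c > 1 \<Longrightarrow> \<omega> < v \<and> v < 0 \<and> Phi_slope (of_real v) = 0 \<longleftrightarrow> v = p'"
  shows "c \<le> 1 \<Longrightarrow> measure_support \<nu> = {0..Phi p}"
    and "c > 1 \<Longrightarrow> measure_support \<nu> = {0} \<union> {Phi p'..Phi p}"
proof -
  note up = upper_edge[OF p]
  have Phip: "Phi p > 0" using Phi_right(3)[OF up(1)] by (smt (verit) zero_le_power2)
  have zero: "0 \<in> measure_support \<nu>" using repel by (rule zero_in_support)
  have above: "x \<notin> measure_support \<nu>" if x: "x > Phi p" for x
  proof -
    obtain w where w: "w > lam 1" "Phi w = x" "Phi_slope (of_real w) > 0" using up(3)[OF x] by blast
    then have "w \<notin> (eigs :: real set)" using notin_eigs_outside by blast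
    then show ?thesis
      using increasing_branch_outside_support[of w] Phi_right(4,5)[OF w(1)] w by simp
  qed
  have gap: "x \<notin> measure_support \<nu>" if c: "c > 1" and x: "0 < x" "x < Phi p'" for x
  proof -
    note low = lower_edge[OF conjunct1[OF \<omega>[OF c]] conjunct2[OF \<omega>[OF c]] p'[OF c]]
    obtain w where w: "\<omega> < w" "w < 0" "Phi w = x" "Phi_slope (of_real w) > 0" using low(6)[OF x] by blast
    then have "w \<notin> (eigs :: real set)" using notin_eigs_outside lamM_pos by force
    then show ?thesis
      using increasing_branch_outside_support[of w] low(4)[OF w(1,2)] w by simp
  qed
  have inside: "Phi p < x \<or> c > 1 \<and> x < Phi p'" if x: "x \<notin> measure_support \<nu>" "x > 0" for x
  proof -
    from companion_real_point[OF x(1) repel] obtain w0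
      where w0: "w0 < lam M \<or> lam 1 < w0" "Phi w0 = x" "q_slope w0 \<le> 1" "Phi_slope (of_real w0) > 0" by blast
    from w0(1,3) have "Phi w0 > 0 \<Longrightarrow> ?thesis"
    proof (rule branch_cases)
      assume "lam 1 < w0"
      then show ?thesis using up(2)[of w0] w0 by simp
    next
      assume "w0 < 0" "mres w0 > 1 / c" and c: "c > 1"
      note low = lower_edge[OF conjunct1[OF \<omega>[OF c]] conjunct2[OF \<omega>[OF c]] p'[OF c]]
      have "\<omega> < w0"
      proof (rule ccontr)
        assume "\<not> \<omega> < w0"
        then have "mres w0 \<le> mres \<omega>"
          using mres_strict_mono[of w0 \<omega>] \<omega>[OF c] lamM_pos by (cases "w0 = \<omega>") auto
        then show False using \<open>mres w0 > 1 / c\<close> \<omega>[OF c] by simp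
      qed
      then show ?thesis using low(5)[of w0] c \<open>w0 < 0\<close> w0 by simp
    qed
    then show ?thesis using w0(2) x(2) by simp
  qed
  have closure: "{u..v} \<subseteq> measure_support \<nu>" if "u < v" "{u<..<v} \<subseteq> measure_support \<nu>" for u v
    using closure_minimal[OF that(2) closed_measure_support[OF sets]] that(1) by simp
  show "measure_support \<nu> = {0..Phi p}" if "c \<le> 1"
  proof
    show "measure_support \<nu> \<subseteq> {0..Phi p}"
      using above negative_outside_support by (meson atLeastAtMost_iff not_le subsetI)
    have "{0<..<Phi p} \<subseteq> measure_support \<nu>" using inside that by force
    then show "{0..Phi p} \<subseteq> measure_support \<nu>" using closure Phip by blast
  qed
  show "measure_support \<nu> = {0} \<union> {Phi p'..Phi p}" if c: "c > 1"
  proof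
    note low = lower_edge[OF conjunct1[OF \<omega>[OF c]] conjunct2[OF \<omega>[OF c]] p'[OF c]]
    show "measure_support \<nu> \<subseteq> {0} \<union> {Phi p'..Phi p}"
    proof
      fix x assume "x \<in> measure_support \<nu>"
      then have "\<not> Phi p < x" "\<not> x < 0" "\<not> (0 < x \<and> x < Phi p')"
        using above negative_outside_support gap[OF c] by blast+
      then show "x \<in> {0} \<union> {Phi p'..Phi p}" by auto
    qed
    have "Phi p' < Phi p" using Phi_left_less_Phi_right[OF low(2) up(1)] .
    moreover have "Phi p' > 0" using low(3) .
    ultimately have "{Phi p'<..<Phi p} \<subseteq> measure_support \<nu>" using inside by force
    then show "{0} \<union> {Phi p'..Phi p} \<subseteq> measure_support \<nu>"
      using closure zero \<open>Phi p' < Phi p\<close> by blast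
  qed
qed

end

section \<open>From matrices to their eigenvalues\<close>

locale positive_matrix =
  fixes n :: nat and c a :: real and R :: "complex mat"
  assumes n: "n \<ge> 1" and c_pos: "c > 0" and a_pos: "a > 0"
    and R: "R \<in> carrier_mat n n" and hermitian: "hermitian_mat R"
    and lower: "pos_semidef_mat (R - of_real a \<cdot>\<^sub>m 1\<^sub>m n)"
begin

lemma eigval_ge:
  assumes "1 \<le> k" "k \<le> n"
  shows "a \<le> eigval R k"
proof -
  have "eigenvalue R (of_real (eigval R k))"
    using assms eigenvalue_iff_eigval[OF hermitian R] by auto
  from eigenvalue_ge_if_pos_semidef[OF R lower this] show ?thesis by simp
qed

sublocale finite_spectrum n c "eigval R"
proof
  show "0 < eigval R k" if "1 \<le> k" "k \<le> n" for k using eigval_ge[OF that] a_pos by simp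
qed (use n c_pos eigval_antimono[OF hermitian R] in auto)

lemma eigenvalue_of_real_iff: "eigenvalue R (of_real w) \<longleftrightarrow> w \<in> eigs"
  unfolding eigenvalue_iff_eigval[OF hermitian R] by (auto simp: eigs_def)

lemma res_trace_eq_mres:
  assumes "w \<notin> eigs"
  shows "res_trace R w = mres w"
proof -
  have "R - of_real w \<cdot>\<^sub>m 1\<^sub>m n = (- of_real w) \<cdot>\<^sub>m 1\<^sub>m n + 1 \<cdot>\<^sub>m R"
    using R by (intro eq_matI) auto
  also have "mat_trace (R * minv \<dots>) =
      (\<Sum>k=1..n. of_real (eigval R k) / (- of_real w + 1 * of_real (eigval R k)))"
  proof (rule mat_trace_mult_minv_eigval[OF hermitian R])
    fix k assume "1 \<le> k" "k \<le> n"
    then have "eigval R k - w \<noteq> 0" using notin_eigs[OF assms, of k] by simp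
    then have "complex_of_real (eigval R k - w) \<noteq> 0" by (simp only: of_real_eq_0_iff not_False_eq_True)
    then show "- of_real w + 1 * complex_of_real (eigval R k) \<noteq> 0" by (simp add: algebra_simps)
  qed
  also have "\<dots> = of_real (\<Sum>k=1..n. eigval R k / (eigval R k - w))"
    by (simp add: algebra_simps)
  finally have "1 / of_nat n * mat_trace (R * minv (R - of_real w \<cdot>\<^sub>m 1\<^sub>m n)) = complex_of_real (mres w)"
    by (simp add: mres_def)
  then show ?thesis using R by (simp add: res_trace_def)
qed

lemma phi_eq_Phi: "w \<notin> eigs \<Longrightarrow> phi c R w = Phi w"
  by (simp add: phi_def res_trace_eq_mres Phi_eq_mres)

lemma phi_critical_iff:
  assumes "w \<notin> eigs"
  shows "(phi c R has_real_derivative 0) (at w) \<longleftrightarrow> Phi_slope (of_real w) = 0"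
proof -
  have "\<forall>\<^sub>F x in nhds w. x \<in> - eigs"
    using assms by (intro eventually_nhds_in_open open_compl_eigs) auto
  then have "\<forall>\<^sub>F x in nhds w. phi c R x = Phi x"
    by eventually_elim (simp add: phi_eq_Phi)
  then have "(phi c R has_real_derivative 0) (at w) \<longleftrightarrow> (Phi has_real_derivative 0) (at w)"
    by (intro DERIV_cong_ev) auto
  then show ?thesis using Phi_slope_zero_iff[OF assms] by simp
qed

text \<open>
  With \<open>w\<close> the companion variable, the matrix to be inverted is \<open>(z / w) (R - w I)\<close>. The sign
  conditions put \<open>w\<close> into the upper half plane, so it is invertible.
\<close>

lemma canonical_eq_iff:
  assumes s: "Im s > 0" "Im (z * s) > 0"
  shows "canonical_eq c R z s \<longleftrightarrow>
    q (of_real c * z * s - 1 / (of_real c * s)) = of_real c * z * s"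
proof -
  let ?c = "complex_of_real c"
  define w where "w = ?c * z * s - 1 / (?c * s)"
  have nz: "s \<noteq> 0" "z \<noteq> 0" "?c \<noteq> 0" using s c_pos by auto
  have "Im (1 / (?c * s)) < 0"
  proof -
    have "1 / (?c * s) = of_real (1 / c) * (1 / s)" by simp
    then have "Im (1 / (?c * s)) = 1 / c * (- Im s / (norm s)\<^sup>2)" by (simp only: Im_of_real_mult Im_one_over)
    also have "\<dots> < 0" using s nz c_pos by (intro mult_pos_neg) (auto simp: divide_neg_pos)
    finally show ?thesis .
  qed
  moreover have "Im (?c * z * s) > 0" using s(2) c_pos by (simp add: mult.assoc del: times_complex.sel) (simp add: Im_of_real_mult)
  ultimately have "Im w > 0" by (simp add: w_def del: times_complex.sel)
  then have w: "w \<noteq> 0" "w \<notin> eigs" using Im_nonzero_notin_eigs[of w] by auto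
  have w_eq: "w = - ((1 - z * ?c\<^sup>2 * s\<^sup>2) / (?c * s))"
    using nz by (simp add: w_def field_simps power2_eq_square)
  define \<alpha> where "\<alpha> = z * ?c * s / (1 - z * ?c\<^sup>2 * s\<^sup>2)"
  have \<alpha>: "\<alpha> = - (z / w)" using w(1) nz unfolding \<alpha>_def w_eq by (simp add: mult_ac)
  have eig: "- z + - \<alpha> * of_real (eigval R k) = z / w * (of_real (eigval R k) - w)" for k
    using w by (simp add: \<alpha> field_simps)
  have "(- z) \<cdot>\<^sub>m 1\<^sub>m n - \<alpha> \<cdot>\<^sub>m R = (- z) \<cdot>\<^sub>m 1\<^sub>m n + (- \<alpha>) \<cdot>\<^sub>m R"
    using R by (intro eq_matI) auto
  also have "mat_trace (R * minv \<dots>) =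
      (\<Sum>k=1..n. of_real (eigval R k) / (- z + - \<alpha> * of_real (eigval R k)))"
  proof (rule mat_trace_mult_minv_eigval[OF hermitian R])
    fix k assume "1 \<le> k" "k \<le> n"
    then show "- z + - \<alpha> * of_real (eigval R k) \<noteq> 0"
      unfolding eig using notin_eigs[OF w(2), of k] w nz by simp
  qed
  also have "\<dots> = (\<Sum>k=1..n. 1 / z * (of_real (eigval R k) * w / (of_real (eigval R k) - w)))"
    unfolding eig by simp
  also have "\<dots> = 1 / z * (\<Sum>k=1..n. of_real (eigval R k) * w / (of_real (eigval R k) - w))"
    by (simp only: sum_distrib_left)
  finally have "1 / of_nat n * mat_trace (R * minv ((- z) \<cdot>\<^sub>m 1\<^sub>m n - \<alpha> \<cdot>\<^sub>m R)) = q w / (?c * z)"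
    using nz by (simp add: q_def)
  then have "canonical_eq c R z s \<longleftrightarrow> s = q w / (?c * z)"
    using R by (simp add: canonical_eq_def \<alpha>_def)
  also have "\<dots> \<longleftrightarrow> q w = ?c * z * s" using nz by (auto simp: field_simps)
  finally show ?thesis by (simp only: w_def)
qed

text \<open>
  \<open>mres\<close> tends to 0 at minus infinity and equals 1 at 0, so it takes the value \<open>1 / c < 1\<close>
  on the negative axis.
\<close>

lemma smallest_root_negative:
  assumes "c > 1" "smallest_root c R \<omega>"
  shows "\<omega> < 0" "mres \<omega> = 1 / c"
proof -
  have root: "\<omega> \<notin> eigs" "res_trace R \<omega> = 1 / c"
    and least: "\<And>v. v \<notin> eigs \<Longrightarrow> res_trace R v = 1 / c \<Longrightarrow> \<omega> \<le> v"
    using assms(2) by (auto simp: smallest_root_def Let_def eigenvalue_of_real_iff)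
  show "mres \<omega> = 1 / c" using root by (simp add: res_trace_eq_mres)
  obtain v where v: "v < 0" "mres v = 1 / c" using mres_negative_root[OF assms(1)] .
  then have "v \<notin> eigs" using lamM_pos by (intro notin_eigs_outside) auto
  then show "\<omega> < 0" using least[of v] v by (simp add: res_trace_eq_mres)
qed

end

theorem proposition13:
  fixes L :: nat and M :: "nat \<Rightarrow> nat" and c :: "nat \<Rightarrow> real" and c_lim a b :: real
    and R :: "nat \<Rightarrow> complex mat"
    and t :: "nat \<Rightarrow> complex \<Rightarrow> complex" and \<mu> :: "nat \<Rightarrow> real measure"
    and w_plus w_minus \<omega>1 :: "nat \<Rightarrow> real"
  assumes L: "L \<ge> 1"
    and M: "\<And>N. N \<ge> 1 \<Longrightarrow> M N \<ge> 1"
    and c: "\<And>N. N \<ge> 1 \<Longrightarrow> c N = real (M N) * real L / real N"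
    and c_lim: "c \<longlonglongrightarrow> c_lim" "c_lim > 0"
    and ab: "a > 0" "b > 0"
    and R_dim: "\<And>N. N \<ge> 1 \<Longrightarrow> R N \<in> carrier_mat (M N) (M N)"
    and R_pos: "\<And>N. N \<ge> 1 \<Longrightarrow> pos_def_mat (R N)"
    and R_lower: "\<And>N. N \<ge> 1 \<Longrightarrow> pos_semidef_mat (R N - of_real a \<cdot>\<^sub>m 1\<^sub>m (M N))"
    and R_upper: "\<And>N. N \<ge> 1 \<Longrightarrow> pos_def_mat (of_real b \<cdot>\<^sub>m 1\<^sub>m (M N) - R N)"
    and t: "\<And>N z s. N \<ge> 1 \<Longrightarrow> Im z > 0 \<Longrightarrow>
              canonical_solution (c N) (R N) z s \<longleftrightarrow> s = t N z"
    and \<mu>_finite: "\<And>N. N \<ge> 1 \<Longrightarrow> finite_measure (\<mu> N)"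
    and \<mu>_sets: "\<And>N. N \<ge> 1 \<Longrightarrow> sets (\<mu> N) = sets borel"
    and \<mu>_carrier: "\<And>N. N \<ge> 1 \<Longrightarrow> emeasure (\<mu> N) {..<0} = 0"
    and \<mu>_stieltjes: "\<And>N z. N \<ge> 1 \<Longrightarrow> Im z > 0 \<Longrightarrow> t N z = stieltjes (\<mu> N) z"
    and w_plus: "\<And>N. N \<ge> 1 \<Longrightarrow>
              unique_critical_point (phi (c N) (R N)) {eigval (R N) 1<..} (w_plus N)"
    and \<omega>1: "\<And>N. N \<ge> 1 \<Longrightarrow> c N > 1 \<Longrightarrow> smallest_root (c N) (R N) (\<omega>1 N)"
    and w_minus: "\<And>N. N \<ge> 1 \<Longrightarrow> c N > 1 \<Longrightarrow>
              unique_critical_point (phi (c N) (R N)) {\<omega>1 N<..<0} (w_minus N)"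
    and spacing: "\<exists>\<kappa>>0. \<forall>\<^sub>F N in sequentially.
              \<forall>k l. 1 \<le> k \<and> k \<le> l \<and> l \<le> M N \<longrightarrow>
                \<bar>eigval (R N) k - eigval (R N) l\<bar>
                  \<le> \<kappa> * sqrt (\<bar>real k - real l\<bar> / real (M N))"
  shows "\<forall>\<^sub>F N in sequentially.
           (c N \<le> 1 \<longrightarrow>
              measure_support (\<mu> N) = {0..phi (c N) (R N) (w_plus N)}) \<and>
           (c N > 1 \<longrightarrow>
              measure_support (\<mu> N) =
                {0} \<union> {phi (c N) (R N) (w_minus N)..phi (c N) (R N) (w_plus N)})"
proof -
  obtain \<kappa> where \<kappa>: "\<kappa> > 0" and spaced: "\<forall>\<^sub>F N in sequentially.
      \<forall>k l. 1 \<le> k \<and> k \<le> l \<and> l \<le> M N \<longrightarrow>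
        \<bar>eigval (R N) k - eigval (R N) l\<bar> \<le> \<kappa> * sqrt (\<bar>real k - real l\<bar> / real (M N))"
    using spacing by blast
  have c_pos: "c N > 0" if "N \<ge> 1" for N
    using that L M[OF that] by (simp add: c[OF that])
  have "filterlim (\<lambda>N. c N * (real N / real L)) at_top sequentially"
  proof (rule filterlim_tendsto_pos_mult_at_top[OF c_lim])
    show "filterlim (\<lambda>N. real N / real L) at_top sequentially"
      using filterlim_tendsto_pos_mult_at_top[OF tendsto_const[of "1 / real L"] _ filterlim_real_sequentially] L
      by simp
  qed
  then have "filterlim (\<lambda>N. real (M N)) at_top sequentially"
  proof (rule filterlim_mono_eventually[OF _ order_refl order_refl])
    show "\<forall>\<^sub>F N in sequentially. c N * (real N / real L) = real (M N)"
      using eventually_ge_at_top[of 1] by eventually_elim (use L c in simp)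
  qed
  then have "filterlim M sequentially sequentially"
    by (simp add: filterlim_sequentially_iff_filterlim_real)
  then have "filterlim (\<lambda>N. harm (M N) :: real) at_top sequentially"
    by (rule filterlim_compose[OF harm_at_top])
  then have harm_large: "\<forall>\<^sub>F N in sequentially. 8 * \<kappa>\<^sup>2 / (c_lim * a\<^sup>2) \<le> harm (M N)"
    by (simp add: filterlim_at_top)
  have c_large: "\<forall>\<^sub>F N in sequentially. c_lim / 2 < c N"
    using c_lim by (intro order_tendstoD(1)) auto
  from spaced harm_large c_large eventually_ge_at_top[of "1 :: nat"] show ?thesis
  proof eventually_elim
    case (elim N)
    have N: "N \<ge> 1" by fact
    have "hermitian_mat (R N)" using R_pos[OF N] by (simp add: pos_def_mat_def)
    then interpret positive_matrix "M N" "c N" a "R N"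
      using M[OF N] c_pos[OF N] ab(1) R_dim[OF N] R_lower[OF N] by (intro positive_matrix.intro)
    interpret spectral_law "M N" "c N" "eigval (R N)" "t N" "\<mu> N"
    proof (intro spectral_law.intro spectral_law_axioms.intro)
      fix z s :: complex assume z: "Im z > 0"
      show "(Im s > 0 \<and> Im (z * s) > 0 \<and>
          q (of_real (c N) * z * s - 1 / (of_real (c N) * s)) = of_real (c N) * z * s) \<longleftrightarrow> s = t N z"
        using t[OF N z, of s] canonical_eq_iff[of s z] unfolding canonical_solution_def by blast
      show "t N z = stieltjes (\<mu> N) z" by (rule \<mu>_stieltjes[OF N z])
    qed (rule finite_spectrum_axioms \<mu>_finite[OF N] \<mu>_sets[OF N] \<mu>_carrier[OF N])+
    have harm: "4 * \<kappa>\<^sup>2 / (c N * a\<^sup>2) \<le> harm (M N)"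
    proof -
      have "4 * \<kappa>\<^sup>2 / (c N * a\<^sup>2) \<le> 4 * \<kappa>\<^sup>2 / (c_lim / 2 * a\<^sup>2)"
        using elim(3) c_lim ab by (intro divide_left_mono mult_right_mono mult_pos_pos) auto
      also have "\<dots> = 8 * \<kappa>\<^sup>2 / (c_lim * a\<^sup>2)" by simp
      finally show ?thesis using elim(2) by simp
    qed
    have repel: "\<exists>\<eta>>0. \<forall>w. Im w > 0 \<longrightarrow> norm (w - complex_of_real w0) < \<eta> \<longrightarrow> q_slope w \<ge> 1"
      if w0: "eigval (R N) (M N) \<le> w0" "w0 \<le> eigval (R N) 1" for w0
    proof (intro exI[of _ "\<kappa> / sqrt (real (M N))"] conjI allI impI)
      show "\<kappa> / sqrt (real (M N)) > 0" using \<kappa> n by simp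
      fix w assume w: "Im w > 0" "norm (w - complex_of_real w0) < \<kappa> / sqrt (real (M N))"
      show "q_slope w \<ge> 1"
      proof (rule q_slope_ge_1_near_spectrum[OF ab(1) eigval_ge \<kappa> _ harm w0 less_imp_le[OF w(2)]])
        show "w \<notin> eigs" using w(1) by (intro Im_nonzero_notin_eigs) simp
      qed (use elim(1) in auto)
    qed
    have right: "v \<notin> (eigs :: real set)" if "v > eigval (R N) 1" for v
      using that by (intro notin_eigs_outside) simp
    have left: "v \<notin> (eigs :: real set)" if "v < 0" for v
      using that lamM_pos by (intro notin_eigs_outside) simp
    have crit: "v > eigval (R N) 1 \<and> Phi_slope (of_real v) = 0 \<longleftrightarrow> v = w_plus N" for v
      using w_plus[OF N] phi_critical_iff[OF right[of v]] unfolding unique_critical_point_def by auto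
    have root: "\<omega>1 N < 0 \<and> mres (\<omega>1 N) = 1 / c N" if "c N > 1"
      using smallest_root_negative[OF that \<omega>1[OF N that]] by blast
    have crit': "\<omega>1 N < v \<and> v < 0 \<and> Phi_slope (of_real v) = 0 \<longleftrightarrow> v = w_minus N" if "c N > 1" for v
      using w_minus[OF N that] phi_critical_iff[OF left[of v]] unfolding unique_critical_point_def by auto
    have "w_plus N > eigval (R N) 1" using crit by blast
    then have plus: "phi (c N) (R N) (w_plus N) = Phi (w_plus N)" by (intro phi_eq_Phi right)
    have minus: "phi (c N) (R N) (w_minus N) = Phi (w_minus N)" if "c N > 1"
      using crit'[OF that, of "w_minus N"] by (intro phi_eq_Phi left) simp
    note supp = support_eq[OF repel crit root crit']
    show ?case using supp plus minus by simp
  qed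
qed

end
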